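(* Let $X$ be a Lévy process on $\mathbb{R}$, let $q>0$, and let $f:U_+\to\mathbb{R}$ be a measurable and uniformly bounded function such that $((\mathcal{E}^-_q\otimes I)f_+)\circ\Delta:\mathbb{R}\to\mathbb{R}$ is measurable. Then (i) for any $x_1\le x_2$, $$q\tilde V(f;q;x_1,x_2)=((\mathcal{E}_q\otimes I)f_+)(x_1,x_2)+(\mathcal{E}^+_q\, w(f;q,\cdot,x_2))(x_1),$$ where $$w(f;q,y,x_2)=\mathbf{1}_{[x_2,+\infty)}(y)\Big(((\mathcal{E}^-_q\otimes I)f_+)(y,y)-((\mathcal{E}^-_q\otimes I)f_+)(y,x_2)\Big);$$ (ii) the right-hand sides of the two displayed formulas in (i), viewed as functions of $q>0$ (with the other arguments fixed), admit analytic continuation with respect to $q$ to the right half-plane $\{\Re q>0\}$.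
   Context: $X=(X_t)_{t\ge0}$ is a one-dimensional Lévy process with $X_0=0$ on a filtered probability space satisfying the usual conditions, with probability $\mathbb{Q}$ and expectation $\mathbb{E}$. Put $\bar X_t=\sup_{0\le s\le t}X_s$, $\underline X_t=\inf_{0\le s\le t}X_s$. For $q>0$, $T_q$ is an exponentially distributed random variable of mean $1/q$ independent of $X$. The expected present value operators are $\mathcal{E}_qu(x)=\mathbb{E}[u(x+X_{T_q})]$, $\mathcal{E}^+_qu(x)=\mathbb{E}[u(x+\bar X_{T_q})]$, $\mathcal{E}^-_qu(x)=\mathbb{E}[u(x+\underline X_{T_q})]$. $I$ is the identity operator; for an operator $A$ on functions of one real variable, $A\otimes I$ acts on a function of $(x_1,x_2)$ through the first variable, with $x_2$ fixed, e.g. $((\mathcal{E}^-_q\otimes I)g)(x_1,x_2)=\mathbb{E}[g(x_1+\underline X_{T_q},x_2)]$. $\Delta(x)=(x,x)$ is the diagonal map. $U_+=\{(x_1,x_2)\in\mathbb{R}^2 : x_2\ge0,\ x_1\le x_2\}$, and $f_+$ is the extension of $f:U_+\to\mathbb{R}$ by zero to $\mathbb{R}^2$. For $T>0$ and $x_1\le x_2$, $V(f;T;x_1,x_2)=\mathbb{E}[f_+(x_1+X_T,\max\{x_2,x_1+\bar X_T\})]$ (when $x_2\ge 0$ the argument lies in $U_+$, so $f_+$ may be replaced by $f$), and $\tilde V(f;q;x_1,x_2)=\int_0^{\infty}e^{-qT}V(f;T;x_1,x_2)\,dT=q^{-1}\mathbb{E}[f_+(x_1+X_{T_q},\max\{x_2,x_1+\bar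 X_{T_q}\})]$ is the Laplace transform in $T$. *)

theory Defs
  imports "HOL-Probability.Probability" "HOL-Complex_Analysis.Complex_Analysis"
begin

section \<open>Levy processes\<close>

text \<open>Time is \<open>[0,\<infinity>)\<close> throughout; the values of \<open>F\<close> and \<open>X\<close> at negative real indices play no role.\<close>

locale usual_filtered_prob_space = prob_space M + complete_measure M
  for M :: "'a measure" +
  fixes F :: "real \<Rightarrow> 'a measure"
  assumes subalgebra_F: "0 \<le> t \<Longrightarrow> subalgebra M (F t)"
    and F_mono: "0 \<le> s \<Longrightarrow> s \<le> t \<Longrightarrow> sets (F s) \<subseteq> sets (F t)"
    and F_null_sets: "null_sets M \<subseteq> sets (F 0)"
    and F_right_continuous: "0 \<le> t \<Longrightarrow> sets (F t) = (\<Inter>s\<in>{t<..}. sets (F s))"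

definition cadlag :: "(real \<Rightarrow> real) \<Rightarrow> bool" where
  "cadlag x \<longleftrightarrow> (\<forall>t\<ge>0. (x \<longlongrightarrow> x t) (at_right t)) \<and> (\<forall>t>0. \<exists>l. (x \<longlongrightarrow> l) (at_left t))"

locale levy_process = usual_filtered_prob_space M F
  for M :: "'a measure" and F +
  fixes X :: "real \<Rightarrow> 'a \<Rightarrow> real"
  assumes adapted: "0 \<le> t \<Longrightarrow> X t \<in> borel_measurable (F t)"
    and start_zero: "AE \<omega> in M. X 0 \<omega> = 0"
    and cadlag_paths: "AE \<omega> in M. cadlag (\<lambda>t. X t \<omega>)"
    and stationary_increments: "0 \<le> s \<Longrightarrow> s \<le> t \<Longrightarrow>
          distr M borel (\<lambda>\<omega>. X t \<omega> - X s \<omega>) = distr M borel (X (t - s))"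
    and independent_increments: "0 \<le> s \<Longrightarrow> s \<le> t \<Longrightarrow>
          indep_set (sets (F s)) (sets (vimage_algebra (space M) (\<lambda>\<omega>. X t \<omega> - X s \<omega>) borel))"

text \<open>\<open>T q\<close> is the exponential time of mean \<open>1 / q\<close>. Nothing is required of the joint law of
  \<open>T q\<close> and \<open>T q'\<close> for \<open>q \<noteq> q'\<close>. Independence of the whole process is expressed with generated
  sigma-algebras because the library's \<open>indep_var\<close> needs both variables to have the same type.\<close>

locale levy_process_exp_times = levy_process M F X
  for M :: "'a measure" and F and X +
  fixes T :: "real \<Rightarrow> 'a \<Rightarrow> real"
  assumes exponential_T: "0 < q \<Longrightarrow> distributed M lborel (T q) (exponential_density q)"
    and independent_T: "0 < q \<Longrightarrow>
          indep_set
            (sets (vimage_algebra (space M) (\<lambda>\<omega>. \<lambda>t\<in>{0..}. X t \<omega>) (PiM {0..} (\<lambda>_. borel))))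
            (sets (vimage_algebra (space M) (T q) borel))"

text \<open>The suprema and infima are taken in the reals. For cadlag paths they are over bounded nonempty
  sets when \<open>0 \<le> t\<close>, so arbitrary values occur at most on a null set.\<close>

definition running_sup :: "(real \<Rightarrow> 'a \<Rightarrow> real) \<Rightarrow> real \<Rightarrow> 'a \<Rightarrow> real" where
  "running_sup X t \<omega> = (SUP s\<in>{0..t}. X s \<omega>)"

definition running_inf :: "(real \<Rightarrow> 'a \<Rightarrow> real) \<Rightarrow> real \<Rightarrow> 'a \<Rightarrow> real" where
  "running_inf X t \<omega> = (INF s\<in>{0..t}. X s \<omega>)"

section \<open>Expected present value operators\<close>

definition EPV :: "'a measure \<Rightarrow> (real \<Rightarrow> 'a \<Rightarrow> real) \<Rightarrow> (real \<Rightarrow> 'a \<Rightarrow> real) \<Rightarrow> real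
    \<Rightarrow> (real \<Rightarrow> real) \<Rightarrow> real \<Rightarrow> real" where
  "EPV M X T q u x = (LINT \<omega>|M. u (x + X (T q \<omega>) \<omega>))"

definition EPV_sup :: "'a measure \<Rightarrow> (real \<Rightarrow> 'a \<Rightarrow> real) \<Rightarrow> (real \<Rightarrow> 'a \<Rightarrow> real) \<Rightarrow> real
    \<Rightarrow> (real \<Rightarrow> real) \<Rightarrow> real \<Rightarrow> real" where
  "EPV_sup M X T q u x = (LINT \<omega>|M. u (x + running_sup X (T q \<omega>) \<omega>))"

definition EPV_inf :: "'a measure \<Rightarrow> (real \<Rightarrow> 'a \<Rightarrow> real) \<Rightarrow> (real \<Rightarrow> 'a \<Rightarrow> real) \<Rightarrow> real
    \<Rightarrow> (real \<Rightarrow> real) \<Rightarrow> real \<Rightarrow> real" where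
  "EPV_inf M X T q u x = (LINT \<omega>|M. u (x + running_inf X (T q \<omega>) \<omega>))"

definition tensor_id :: "((real \<Rightarrow> real) \<Rightarrow> real \<Rightarrow> real) \<Rightarrow> (real \<times> real \<Rightarrow> real)
    \<Rightarrow> real \<times> real \<Rightarrow> real" where
  "tensor_id A g = (\<lambda>(x1, x2). A (\<lambda>y. g (y, x2)) x1)"

definition diag :: "real \<Rightarrow> real \<times> real" where
  "diag x = (x, x)"

section \<open>Value functions\<close>

definition U_plus :: "(real \<times> real) set" where
  "U_plus = {(x1, x2). 0 \<le> x2 \<and> x1 \<le> x2}"

definition ext_zero :: "(real \<times> real \<Rightarrow> real) \<Rightarrow> real \<times> real \<Rightarrow> real" where
  "ext_zero f p = (if p \<in> U_plus then f p else 0)"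

definition V :: "'a measure \<Rightarrow> (real \<Rightarrow> 'a \<Rightarrow> real) \<Rightarrow> (real \<times> real \<Rightarrow> real)
    \<Rightarrow> real \<Rightarrow> real \<Rightarrow> real \<Rightarrow> real" where
  "V M X f t x1 x2 =
     (LINT \<omega>|M. ext_zero f (x1 + X t \<omega>, max x2 (x1 + running_sup X t \<omega>)))"

definition V_laplace :: "'a measure \<Rightarrow> (real \<Rightarrow> 'a \<Rightarrow> real) \<Rightarrow> (real \<times> real \<Rightarrow> real)
    \<Rightarrow> real \<Rightarrow> real \<Rightarrow> real \<Rightarrow> real" where
  "V_laplace M X f q x1 x2 = (LINT t:{0<..}|lborel. exp (- q * t) * V M X f t x1 x2)"

definition w :: "'a measure \<Rightarrow> (real \<Rightarrow> 'a \<Rightarrow> real) \<Rightarrow> (real \<Rightarrow> 'a \<Rightarrow> real)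
    \<Rightarrow> (real \<times> real \<Rightarrow> real) \<Rightarrow> real \<Rightarrow> real \<Rightarrow> real \<Rightarrow> real" where
  "w M X T f q y x2 =
     indicator {x2..} y *
       (tensor_id (EPV_inf M X T q) (ext_zero f) (y, y)
        - tensor_id (EPV_inf M X T q) (ext_zero f) (y, x2))"

definition continues_to_right_half_plane :: "(real \<Rightarrow> real) \<Rightarrow> bool" where
  "continues_to_right_half_plane h \<longleftrightarrow>
     (\<exists>H :: complex \<Rightarrow> complex. H analytic_on {z. 0 < Re z} \<and>
        (\<forall>q>0. H (complex_of_real q) = complex_of_real (h q)))"

end

theory Submission
  imports Defs
begin

text \<open>
  For an exponential time \<open>T\<close> of rate \<open>q\<close> independent of the process, write \<open>S\<close>, \<open>I\<close> for the running
  supremum and infimum at \<open>T\<close>. Fubini turns \<open>q\<close> times the Laplace transform of the value function into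
  the expectation of \<open>f\<close> at \<open>(x1 + X\<^sub>T, max x2 (x1 + S))\<close>. The second coordinate is \<open>x2\<close> unless \<open>x1 + S\<close>
  reaches \<open>x2\<close>, so this expectation is that of \<open>f (x1 + X\<^sub>T, x2)\<close> plus the correction
  \<open>f (x1 + X\<^sub>T, x1 + S) - f (x1 + X\<^sub>T, x2)\<close> on the event \<open>x1 + S \<ge> x2\<close>. The correction is a function of the
  pair \<open>(S, X\<^sub>T - S)\<close>. By the Wiener-Hopf factorization (\<open>wiener_hopf\<close>) its components are
  independent and the second is distributed like \<open>I\<close>. Integrating out the second component first
  gives the expected present value of \<open>w\<close> (\<open>V_laplace_decomposition\<close>).

  The factorization is proved by discretization. For a random walk stopped at an independent
  geometric time, splitting the path at the first time of its maximum writes the expectation of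
  \<open>\<phi> (max) * \<psi> (end - max)\<close> for each fixed number of steps as a convolution of a
  sequence depending only on \<open>\<phi>\<close> with one depending only on \<open>\<psi>\<close>. Generating functions turn the
  convolution into a product, which is independence, and reversing the order of the steps identifies
  the law of \<open>end - max\<close> with that of the minimum (\<open>wiener_hopf_geometric\<close>,
  \<open>drawdown_mean_eq_min_mean\<close>). Sampling the Levy process on a grid gives such walks. When the mesh
  tends to \<open>0\<close>, right-continuity of the paths makes the sampled maxima and minima converge, and the
  factorization passes to the limit for continuous \<open>\<phi>\<close>, \<open>\<psi>\<close>. Approximating indicators of half-lines
  extends it to an identity of laws.

  For the continuation in \<open>q\<close>, both right-hand sides are \<open>q\<close> times the Laplace transform
  at \<open>q\<close> of one bounded measurable function of time that does not depend on \<open>q\<close>. For the first this is the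
  decomposition read backwards, for \<open>w\<close> it is Fubini again. Such a transform is holomorphic on the
  right half-plane by differentiation under the integral (\<open>laplace_transform_holomorphic\<close>).
\<close>

section \<open>Grid approximation of cadlag paths\<close>

definition mesh :: "nat \<Rightarrow> real" where
  "mesh n = 1 / real (Suc n)"

text \<open>Time is rounded up, so that the grid time \<open>steps n t * mesh n\<close> approaches \<open>t\<close> from the right,
  the side on which a cadlag path is continuous.\<close>

definition steps :: "nat \<Rightarrow> real \<Rightarrow> nat" where
  "steps n t = nat \<lceil>real (Suc n) * t\<rceil>"

lemma mesh_pos: "0 < mesh n"
  by (simp add: mesh_def)

lemma mesh_tendsto_0: "mesh \<longlonglongrightarrow> 0"
  unfolding mesh_def using LIMSEQ_Suc[OF lim_1_over_n[where 'a=real]] by simp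

lemma steps_mesh_bounds:
  assumes "0 \<le> t"
  shows "t \<le> steps n t * mesh n" "steps n t * mesh n \<le> t + mesh n"
proof -
  have nn: "0 \<le> real (Suc n) * t" using assms by simp
  have eq: "real (steps n t) = real_of_int \<lceil>real (Suc n) * t\<rceil>"
    unfolding steps_def using nn by (subst of_nat_nat) (auto simp del: of_nat_Suc)
  have "real (Suc n) * t \<le> real (steps n t)" "real (steps n t) \<le> real (Suc n) * t + 1"
    unfolding eq by linarith+
  then show "t \<le> steps n t * mesh n" "steps n t * mesh n \<le> t + mesh n"
    by (simp_all add: mesh_def divide_simps del: of_nat_Suc) (simp_all add: algebra_simps del: of_nat_Suc)
qed

lemma steps_mono: "s \<le> t \<Longrightarrow> steps n s \<le> steps n t"
  unfolding steps_def by (intro nat_mono ceiling_mono mult_left_mono) auto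

lemma steps_mesh_tendsto:
  assumes "0 \<le> t"
  shows "(\<lambda>n. steps n t * mesh n) \<longlonglongrightarrow> t"
proof (rule tendsto_sandwich[where f="\<lambda>n. t" and h="\<lambda>n. t + mesh n"])
  show "(\<lambda>n. t + mesh n) \<longlonglongrightarrow> t"
    using tendsto_add[OF tendsto_const mesh_tendsto_0, of t] by simp
  show "(\<lambda>n. t) \<longlonglongrightarrow> t" by simp
qed (use steps_mesh_bounds[OF assms] in auto)

lemma steps_le_iff: "steps N t \<le> k \<longleftrightarrow> t \<le> real k * mesh N"
proof -
  have "steps N t \<le> k \<longleftrightarrow> real (Suc N) * t \<le> real k"
    unfolding steps_def by (simp add: nat_le_iff ceiling_le_iff del: of_nat_Suc)
  also have "\<dots> \<longleftrightarrow> t \<le> real k * mesh N"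
    by (simp add: mesh_def pos_le_divide_eq mult.commute del: of_nat_Suc)
  finally show ?thesis .
qed

lemma measurable_steps [measurable]: "steps n \<in> measurable borel (count_space UNIV)"
  unfolding steps_def by measurable

lemma cadlag_tendsto_from_right:
  assumes x: "cadlag x" and t: "0 \<le> t" and s: "\<And>n. t \<le> s n" "s \<longlonglongrightarrow> t"
  shows "(\<lambda>n. x (s n)) \<longlonglongrightarrow> x t"
proof -
  have "continuous (at t within {t..}) x"
    using x t by (simp add: continuous_within at_within_Ici_at_right cadlag_def)
  from continuous_within_tendsto_compose'[OF this _ s(2)] s(1) show ?thesis by simp
qed

text \<open>The one-sided limits bound the path near every point, and bounded neighbouring intervals can be
  glued, so Bolzano's bisection principle applies. Since suprema of unbounded sets are arbitrary,
  this is what gives the running supremum a meaning.\<close>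

lemma cadlag_bounded:
  assumes x: "cadlag x"
  shows "bounded (x ` {0..t})"
proof (cases "0 \<le> t")
  case True
  \<comment> \<open>Bolzano's principle also tests intervals that reach below \<open>0\<close>, where the path is arbitrary.\<close>
  define P where "P a b = bounded (x ` ({a..b} \<inter> {0..}))" for a b
  have "P 0 t"
  proof (rule Bolzano[OF True])
    fix a b c :: real assume ab: "P a b" and bc: "P b c" and "a \<le> b" "b \<le> c"
    then have "{a..c} \<inter> {0..} = ({a..b} \<inter> {0..}) \<union> ({b..c} \<inter> {0..})" by auto
    then show "P a c" using ab bc unfolding P_def by (simp add: image_Un)
  next
    fix s :: real assume s: "0 \<le> s" "s \<le> t"
    have "(x \<longlongrightarrow> x s) (at_right s)" using x s by (simp add: cadlag_def)
    then have "\<forall>\<^sub>F u in at_right s. dist (x u) (x s) < 1"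
      by (rule tendstoD) simp
    then obtain d1 where d1: "s < d1" "\<And>u. s < u \<Longrightarrow> u < d1 \<Longrightarrow> dist (x u) (x s) < 1"
      unfolding eventually_at_right_field by auto
    have "\<exists>d2<s. \<exists>l. \<forall>u. 0 \<le> u \<longrightarrow> d2 < u \<longrightarrow> u < s \<longrightarrow> dist (x u) l < 1"
    proof (cases "s = 0")
      case True then show ?thesis by (intro exI[of _ "-1"]) auto
    next
      case False
      then obtain l where "(x \<longlongrightarrow> l) (at_left s)" using x s by (force simp: cadlag_def)
      then have "\<forall>\<^sub>F u in at_left s. dist (x u) l < 1" by (rule tendstoD) simp
      then show ?thesis unfolding eventually_at_left_field by auto
    qed
    then obtain d2 l where d2: "d2 < s" "\<And>u. 0 \<le> u \<Longrightarrow> d2 < u \<Longrightarrow> u < s \<Longrightarrow> dist (x u) l < 1"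
      by blast
    show "\<exists>d>0. \<forall>a b. a \<le> s \<and> s \<le> b \<and> b - a < d \<longrightarrow> P a b"
    proof (intro exI[of _ "min (d1 - s) (s - d2)"] conjI allI impI)
      fix a b assume ab: "a \<le> s \<and> s \<le> b \<and> b - a < min (d1 - s) (s - d2)"
      have "x ` ({a..b} \<inter> {0..}) \<subseteq> ball l 1 \<union> cball (x s) 1"
      proof
        fix v assume "v \<in> x ` ({a..b} \<inter> {0..})"
        then obtain u where u: "v = x u" "a \<le> u" "u \<le> b" "0 \<le> u" by auto
        show "v \<in> ball l 1 \<union> cball (x s) 1"
        proof (cases u s rule: linorder_cases)
          case less
          then show ?thesis using d2(2)[of u] u ab by (auto simp: dist_commute)
        next
          case greater
          then show ?thesis using d1(2)[of u] u ab by (auto simp: dist_commute)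
        qed (use u in auto)
      qed
      then show "P a b" unfolding P_def by (rule bounded_subset[rotated]) simp
    qed (use d1 d2 in auto)
  qed
  moreover have "{0..t} \<inter> {0..} = {0..t}" by auto
  ultimately show ?thesis by (simp add: P_def)
qed auto

text \<open>Every earlier time \<open>s\<close> is approached from the right by grid times, which gives the lower bound.
  The grid overshoots \<open>t\<close> by at most one mesh, where the path is close to its value at \<open>t\<close>, which gives
  the upper bound.\<close>

lemma cadlag_grid_max_tendsto:
  assumes x: "cadlag x" and t: "0 \<le> t"
  shows "(\<lambda>n. MAX k\<in>{..steps n t}. x (k * mesh n)) \<longlonglongrightarrow> (SUP s\<in>{0..t}. x s)"
    (is "?m \<longlonglongrightarrow> ?S")
proof -
  have bdd: "bdd_above (x ` {0..u})" for u
    using cadlag_bounded[OF x] by (rule bounded_imp_bdd_above)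
  have grid_in: "x (steps n s * mesh n) \<le> ?m n" if "s \<le> t" for n s
    using steps_mono[OF that] by (intro Max_ge) auto
  show ?thesis
  proof (rule order_tendstoI)
    fix a assume "a < ?S"
    then obtain s where s: "0 \<le> s" "s \<le> t" "a < x s"
      using less_cSUP_iff[OF _ bdd, of t a] t by auto
    have "(\<lambda>n. x (steps n s * mesh n)) \<longlonglongrightarrow> x s"
      using x s(1) steps_mesh_bounds(1)[OF s(1)] steps_mesh_tendsto[OF s(1)]
      by (rule cadlag_tendsto_from_right)
    then have "\<forall>\<^sub>F n in sequentially. a < x (steps n s * mesh n)"
      using s(3) by (rule order_tendstoD(1))
    then show "\<forall>\<^sub>F n in sequentially. a < ?m n"
      by eventually_elim (rule less_le_trans[OF _ grid_in[OF s(2)]])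
  next
    fix a assume a: "?S < a"
    have xt: "x t \<le> ?S" using t by (intro cSUP_upper bdd) auto
    have "(x \<longlongrightarrow> x t) (at_right t)" using x t by (simp add: cadlag_def)
    then have "\<forall>\<^sub>F u in at_right t. x u < a"
      by (rule order_tendstoD(2)) (use a xt in simp)
    then obtain d where d: "t < d" "\<And>u. t < u \<Longrightarrow> u < d \<Longrightarrow> x u < a"
      unfolding eventually_at_right_field by auto
    have "\<forall>\<^sub>F n in sequentially. steps n t * mesh n < d"
      using steps_mesh_tendsto[OF t] d(1) by (rule order_tendstoD(2))
    then show "\<forall>\<^sub>F n in sequentially. ?m n < a"
    proof eventually_elim
      case (elim n)
      have "x (k * mesh n) < a" if "k \<le> steps n t" for k
      proof (cases "k * mesh n \<le> t")
        case True
        then have "x (k * mesh n) \<le> ?S" using mesh_pos[of n] by (intro cSUP_upper bdd) auto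
        then show ?thesis using a by simp
      next
        case False
        have "real k * mesh n \<le> steps n t * mesh n" using that mesh_pos[of n] by simp
        then show ?thesis using False elim by (intro d) auto
      qed
      then show ?case by (subst Max_less_iff) auto
    qed
  qed
qed

lemma cadlag_uminus: "cadlag x \<Longrightarrow> cadlag (\<lambda>t. - x t)"
  unfolding cadlag_def by (blast intro: tendsto_minus)

text \<open>The minimum of a path is minus the maximum of the reflected path.\<close>

lemma cadlag_grid_min_tendsto:
  assumes x: "cadlag x" and t: "0 \<le> t"
  shows "(\<lambda>n. MIN k\<in>{..steps n t}. x (k * mesh n)) \<longlonglongrightarrow> (INF s\<in>{0..t}. x s)"
proof -
  have eq: "- (MAX k\<in>{..steps n t}. - x (k * mesh n)) = (MIN k\<in>{..steps n t}. x (k * mesh n))" for n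
    using minus_Max_eq_Min[of "(\<lambda>k. - x (real k * mesh n)) ` {..steps n t}"]
    by (simp add: image_image)
  have "- (SUP s\<in>{0..t}. - x s) = (INF s\<in>{0..t}. x s)"
    by (simp add: Inf_real_def image_image)
  then show ?thesis
    using tendsto_minus[OF cadlag_grid_max_tendsto[OF cadlag_uminus[OF x] t]] by (simp add: eq)
qed

section \<open>Wiener-Hopf factorization of a random walk\<close>

definition walk :: "(nat \<Rightarrow> real) \<Rightarrow> nat \<Rightarrow> real" where
  "walk y k = (\<Sum>j<k. y j)"

definition walk_max :: "(nat \<Rightarrow> real) \<Rightarrow> nat \<Rightarrow> real" where
  "walk_max y n = (MAX k\<in>{..n}. walk y k)"

definition walk_min :: "(nat \<Rightarrow> real) \<Rightarrow> nat \<Rightarrow> real" where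
  "walk_min y n = (MIN k\<in>{..n}. walk y k)"

text \<open>Together, a strict record at time \<open>k\<close> and later values that do not exceed the one at \<open>k\<close>
  characterize \<open>k\<close> as the first time of the maximum.\<close>

definition strict_record :: "(nat \<Rightarrow> real) \<Rightarrow> nat \<Rightarrow> bool" where
  "strict_record y k \<longleftrightarrow> (\<forall>j<k. walk y j < walk y k)"

definition stays_nonpos :: "(nat \<Rightarrow> real) \<Rightarrow> nat \<Rightarrow> bool" where
  "stays_nonpos y m \<longleftrightarrow> (\<forall>j\<le>m. walk y j \<le> 0)"

definition future_steps :: "nat \<Rightarrow> nat \<Rightarrow> (nat \<Rightarrow> real) \<Rightarrow> nat \<Rightarrow> real" where
  "future_steps k m y = (\<lambda>i\<in>{..<m}. y (k + i))"

definition reverse_steps :: "nat \<Rightarrow> (nat \<Rightarrow> real) \<Rightarrow> nat \<Rightarrow> real" where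
  "reverse_steps n y = (\<lambda>i\<in>{..<n}. y (n - 1 - i))"

lemma walk_restrict: "j \<le> k \<Longrightarrow> walk (restrict y {..<k}) j = walk y j"
  unfolding walk_def by (intro sum.cong) auto

lemma strict_record_restrict: "strict_record (restrict y {..<k}) k = strict_record y k"
  by (simp add: strict_record_def walk_restrict)

lemma walk_future_steps:
  assumes "j \<le> m"
  shows "walk (future_steps k m y) j = walk y (k + j) - walk y k"
proof -
  have "walk (future_steps k m y) j = (\<Sum>i<j. y (k + i))"
    unfolding walk_def future_steps_def using assms by (intro sum.cong) auto
  moreover have "walk y (k + j) = walk y k + (\<Sum>i<j. y (k + i))"
    by (induction j) (simp_all add: walk_def)
  ultimately show ?thesis by simp
qed

lemma walk_reverse_steps:
  assumes "j \<le> n"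
  shows "walk (reverse_steps n y) j = walk y n - walk y (n - j)"
  using assms
proof (induction j)
  case (Suc j)
  have "walk y (n - j) = walk y (n - Suc j) + y (n - Suc j)"
    using Suc.prems by (simp add: walk_def Suc_diff_Suc flip: sum.lessThan_Suc)
  moreover have "walk (reverse_steps n y) (Suc j) = walk (reverse_steps n y) j + y (n - Suc j)"
    using Suc.prems by (simp add: walk_def reverse_steps_def)
  ultimately show ?case using Suc by simp
qed (simp add: walk_def)

text \<open>The reversed walk at time \<open>j\<close> is the total displacement minus the original walk at time \<open>n - j\<close>, so a
  minimum of the one is a maximum of the other.\<close>

lemma walk_min_reverse_steps: "walk_min (reverse_steps n y) n = walk y n - walk_max y n"
proof -
  have "(\<lambda>j. n - j) ` {..n} = {..n}"
    by (auto simp: image_iff intro: bexI[of _ "n - _"]) (metis atMost_iff diff_diff_cancel diff_le_self)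
  then have im: "walk (reverse_steps n y) ` {..n} = (\<lambda>k. walk y n - walk y k) ` {..n}"
    by (smt (verit) atMost_iff image_cong image_image walk_reverse_steps)
  show ?thesis unfolding walk_min_def walk_max_def im
  proof (rule Min_eqI)
    show "y' \<ge> walk y n - (MAX k\<in>{..n}. walk y k)"
      if "y' \<in> (\<lambda>k. walk y n - walk y k) ` {..n}" for y'
      using that by auto
    have "(MAX k\<in>{..n}. walk y k) \<in> walk y ` {..n}" by (intro Max_in) auto
    then show "walk y n - (MAX k\<in>{..n}. walk y k) \<in> (\<lambda>k. walk y n - walk y k) ` {..n}"
      by (metis (no_types, lifting) image_iff)
  qed auto
qed

text \<open>Exactly one summand is nonzero, namely the one at the first time of the maximum. The conditions
  in that summand separate the steps before \<open>k\<close> from those after \<open>k\<close>.\<close>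

lemma first_maximum_decomposition:
  "h (walk_max y n) = (\<Sum>k\<le>n. h (walk y k) *
     (of_bool (strict_record y k) * of_bool (stays_nonpos (future_steps k (n - k) y) (n - k)) :: real))"
proof -
  \<comment> \<open>The first time of the maximum.\<close>
  define K where "K = (LEAST k. k \<le> n \<and> walk y k = walk_max y n)"
  have "walk_max y n \<in> walk y ` {..n}" unfolding walk_max_def by (intro Max_in) auto
  then have ex: "\<exists>k. k \<le> n \<and> walk y k = walk_max y n" by auto
  have K: "K \<le> n" "walk y K = walk_max y n"
    using LeastI_ex[OF ex] unfolding K_def by auto
  have below: "walk y j \<le> walk_max y n" if "j \<le> n" for j
    unfolding walk_max_def using that by (intro Max_ge) auto
  have strict: "walk y j < walk y K" if "j < K" for j
    using not_less_Least[of j "\<lambda>k. k \<le> n \<and> walk y k = walk_max y n"] that K below[of j]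
    unfolding K_def[symmetric] by fastforce
  have nonpos: "stays_nonpos (future_steps k (n - k) y) (n - k) \<longleftrightarrow> (\<forall>j. k \<le> j \<longrightarrow> j \<le> n \<longrightarrow> walk y j \<le> walk y k)"
    if "k \<le> n" for k
    unfolding stays_nonpos_def
  proof (safe)
    fix j assume *: "\<forall>j\<le>n - k. walk (future_steps k (n - k) y) j \<le> 0" "k \<le> j" "j \<le> n"
    then show "walk y j \<le> walk y k"
      using *(1)[rule_format, of "j - k"] by (simp add: walk_future_steps)
  qed (use that in \<open>simp add: walk_future_steps\<close>)
  have "strict_record y k \<and> stays_nonpos (future_steps k (n - k) y) (n - k) \<longleftrightarrow> k = K" if "k \<le> n" for k
  proof
    assume *: "strict_record y k \<and> stays_nonpos (future_steps k (n - k) y) (n - k)"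
    show "k = K"
    proof (rule ccontr)
      assume "k \<noteq> K"
      then consider "K < k" | "k < K" by linarith
      then show False
      proof cases
        case 1
        then have "walk y K < walk y k" using * by (simp add: strict_record_def)
        then show ?thesis using below[OF that] K by simp
      next
        case 2
        then show ?thesis using * nonpos[OF that] K strict[OF 2] by (meson leD less_imp_le)
      qed
    qed
  next
    assume "k = K"
    then show "strict_record y k \<and> stays_nonpos (future_steps k (n - k) y) (n - k)"
      using K strict nonpos[OF K(1)] below by (simp add: strict_record_def)
  qed
  then have "(\<Sum>k\<le>n. h (walk y k) *
     (of_bool (strict_record y k) * of_bool (stays_nonpos (future_steps k (n - k) y) (n - k)) :: real))
     = (\<Sum>k\<le>n. if k = K then h (walk y K) else 0)"
    by (intro sum.cong) auto
  also have "\<dots> = h (walk_max y n)" using K by simp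
  finally show ?thesis by simp
qed

lemma (in prob_space) abs_integral_le:
  fixes u :: "'a \<Rightarrow> real"
  assumes "u \<in> borel_measurable M" "\<And>\<omega>. \<bar>u \<omega>\<bar> \<le> B"
  shows "\<bar>LINT \<omega>|M. u \<omega>\<bar> \<le> B"
proof -
  have int: "integrable M u" using assms by (intro integrable_const_bound[of _ B]) auto
  have "\<bar>LINT \<omega>|M. u \<omega>\<bar> \<le> (LINT \<omega>|M. \<bar>u \<omega>\<bar>)" by (rule integral_abs_bound)
  also have "\<dots> \<le> B" using assms int by (intro integral_le_const) auto
  finally show ?thesis .
qed

locale iid_steps = prob_space \<mu> for \<mu> :: "real measure" +
  assumes sets_step_law [measurable_cong, simp]: "sets \<mu> = sets borel"
begin

abbreviation steps_law :: "nat \<Rightarrow> (nat \<Rightarrow> real) measure" where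
  "steps_law n \<equiv> PiM {..<n} (\<lambda>_. \<mu>)"

lemma prob_space_steps_law: "prob_space (steps_law n)"
  by (intro prob_space_PiM prob_space_axioms)

lemma measurable_walk [measurable]:
  "k \<le> n \<Longrightarrow> (\<lambda>y. walk y k) \<in> borel_measurable (steps_law n)"
  unfolding walk_def by (intro borel_measurable_sum) measurable

lemma measurable_walk_max [measurable]: "(\<lambda>y. walk_max y n) \<in> borel_measurable (steps_law n)"
  unfolding walk_max_def by (intro borel_measurable_Max measurable_walk) auto

lemma measurable_walk_min [measurable]: "(\<lambda>y. walk_min y n) \<in> borel_measurable (steps_law n)"
  unfolding walk_min_def by (intro borel_measurable_Min measurable_walk) auto

lemma measurable_strict_record [measurable]:
  "Measurable.pred (steps_law n) (\<lambda>y. strict_record y n)"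
  unfolding strict_record_def
  by (intro pred_intros_countable pred_intros_imp' borel_measurable_pred_less measurable_walk) auto

lemma measurable_stays_nonpos [measurable]:
  "Measurable.pred (steps_law n) (\<lambda>y. stays_nonpos y n)"
  unfolding stays_nonpos_def not_less[symmetric]
  by (intro pred_intros_countable pred_intros_imp' pred_intros_logic borel_measurable_pred_less measurable_walk) auto

lemma measurable_future_steps [measurable]:
  "k + m \<le> n \<Longrightarrow> future_steps k m \<in> measurable (steps_law n) (steps_law m)"
  unfolding future_steps_def[abs_def] by (intro measurable_restrict measurable_component_singleton) auto

lemma measurable_reverse_steps [measurable]:
  "reverse_steps n \<in> measurable (steps_law n) (steps_law n)"
  unfolding reverse_steps_def[abs_def] by (intro measurable_restrict measurable_component_singleton) auto

lemma integrable_steps_law_bounded: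
  fixes g :: "(nat \<Rightarrow> real) \<Rightarrow> real"
  assumes "g \<in> borel_measurable (steps_law n)" "\<And>y. \<bar>g y\<bar> \<le> B"
  shows "integrable (steps_law n) g"
proof -
  interpret P: prob_space "steps_law n" by (rule prob_space_steps_law)
  show ?thesis using assms by (intro P.integrable_const_bound[of _ B]) auto
qed

text \<open>A product of identical laws is invariant under permuting the coordinates.\<close>

lemma integral_reverse_steps:
  fixes g :: "(nat \<Rightarrow> real) \<Rightarrow> real"
  assumes [measurable]: "g \<in> borel_measurable (steps_law n)"
  shows "(LINT y|steps_law n. g (reverse_steps n y)) = (LINT y|steps_law n. g y)"
proof -
  have "distr (steps_law n) (steps_law n) (reverse_steps n) = steps_law n"
    unfolding reverse_steps_def[abs_def]
    by (rule distr_PiM_reindex) (auto intro: prob_space_axioms inj_onI)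
  then have "(LINT y|steps_law n. g y) = (LINT y|distr (steps_law n) (steps_law n) (reverse_steps n). g y)"
    by simp
  then show ?thesis by (simp add: integral_distr)
qed

text \<open>Independence of past and future steps, with the future moved back to start at index \<open>0\<close>; this
  is where it matters that the steps are identically distributed.\<close>

lemma integral_past_times_future:
  fixes \<alpha> \<beta> :: "(nat \<Rightarrow> real) \<Rightarrow> real"
  assumes [measurable]: "\<alpha> \<in> borel_measurable (steps_law k)" "\<beta> \<in> borel_measurable (steps_law m)"
    and \<alpha>: "\<And>y. \<bar>\<alpha> y\<bar> \<le> A" and \<beta>: "\<And>y. \<bar>\<beta> y\<bar> \<le> B"
  shows "(LINT y|steps_law (k + m). \<alpha> (restrict y {..<k}) * \<beta> (future_steps k m y))
    = (LINT y|steps_law k. \<alpha> y) * (LINT y|steps_law m. \<beta> y)"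
proof -
  interpret PS: product_sigma_finite "\<lambda>_::nat. \<mu>" ..
  have un: "{..<k} \<union> {k..<k+m} = {..<k+m}" by auto
  let ?g = "\<lambda>y. \<alpha> (restrict y {..<k}) * \<beta> (future_steps k m y)"
  have [measurable]: "(\<lambda>y. restrict y {..<k}) \<in> measurable (steps_law (k+m)) (steps_law k)"
    by (intro measurable_restrict_subset) auto
  have meas: "?g \<in> borel_measurable (steps_law (k+m))" by measurable
  have "0 \<le> A" using \<alpha>[of undefined] by linarith
  then have bd: "\<bar>?g y\<bar> \<le> A * B" for y
    by (simp add: abs_mult mult_mono \<alpha> \<beta>)
  have "integrable (PiM ({..<k} \<union> {k..<k+m}) (\<lambda>_. \<mu>)) ?g"
    unfolding un using meas bd by (rule integrable_steps_law_bounded)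
  from PS.product_integral_fold[OF _ _ _ this]
  have "(LINT y|steps_law (k+m). ?g y) =
      (LINT x|PiM {..<k} (\<lambda>_. \<mu>). LINT y|PiM {k..<k+m} (\<lambda>_. \<mu>). ?g (merge {..<k} {k..<k+m} (x, y)))"
    unfolding un by (simp only: ivl_disj_int finite_lessThan finite_atLeastLessThan)
  also have "\<dots> = (LINT x|PiM {..<k} (\<lambda>_. \<mu>). \<alpha> x * (LINT y|PiM {k..<k+m} (\<lambda>_. \<mu>). \<beta> (future_steps k m y)))"
  proof (intro Bochner_Integration.integral_cong refl)
    fix x assume "x \<in> space (PiM {..<k} (\<lambda>_. \<mu>))"
    then have x: "restrict x {..<k} = x" by (auto simp: space_PiM PiE_restrict)
    have "?g (merge {..<k} {k..<k+m} (x, y)) = \<alpha> x * \<beta> (future_steps k m y)" for y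
    proof -
      have "restrict (merge {..<k} {k..<k+m} (x, y)) {..<k} = x"
        by (subst restrict_merge) (auto simp: x)
      moreover have "future_steps k m (merge {..<k} {k..<k+m} (x, y)) = future_steps k m y"
        by (auto simp: future_steps_def merge_def fun_eq_iff)
      ultimately show ?thesis by simp
    qed
    then show "(LINT y|PiM {k..<k+m} (\<lambda>_. \<mu>). ?g (merge {..<k} {k..<k+m} (x, y)))
        = \<alpha> x * (LINT y|PiM {k..<k+m} (\<lambda>_. \<mu>). \<beta> (future_steps k m y))"
      by simp
  qed
  also have "(LINT y|PiM {k..<k+m} (\<lambda>_. \<mu>). \<beta> (future_steps k m y)) = (LINT y|steps_law m. \<beta> y)"
  proof -
    have "distr (PiM {k..<k+m} (\<lambda>_. \<mu>)) (steps_law m) (future_steps k m) = steps_law m"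
      unfolding future_steps_def[abs_def]
      by (rule distr_PiM_reindex) (auto intro: prob_space_axioms inj_onI)
    moreover have "future_steps k m \<in> measurable (PiM {k..<k+m} (\<lambda>_. \<mu>)) (steps_law m)"
      unfolding future_steps_def[abs_def] by (intro measurable_restrict measurable_component_singleton) auto
    ultimately show ?thesis using integral_distr[OF _ assms(2)] by metis
  qed
  finally show ?thesis by (simp only: integral_mult_left_zero)
qed

text \<open>The part of the path before its first maximum contributes this sequence, which depends on \<open>\<phi>\<close> only.\<close>

definition record_mean :: "(real \<Rightarrow> real) \<Rightarrow> nat \<Rightarrow> real" where
  "record_mean \<phi> k = (LINT y|steps_law k. \<phi> (walk y k) * of_bool (strict_record y k))"

text \<open>The part of the path after its first maximum contributes this sequence, which depends on \<open>\<psi>\<close> only.\<close>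

definition nonpos_mean :: "(real \<Rightarrow> real) \<Rightarrow> nat \<Rightarrow> real" where
  "nonpos_mean \<psi> m = (LINT y|steps_law m. \<psi> (walk y m) * of_bool (stays_nonpos y m))"

definition max_drawdown_mean :: "(real \<Rightarrow> real) \<Rightarrow> (real \<Rightarrow> real) \<Rightarrow> nat \<Rightarrow> real" where
  "max_drawdown_mean \<phi> \<psi> n = (LINT y|steps_law n. \<phi> (walk_max y n) * \<psi> (walk y n - walk_max y n))"

text \<open>Splitting the path at the first time \<open>k\<close> of its maximum leaves two independent walks of lengths
  \<open>k\<close> and \<open>n - k\<close>.\<close>

lemma max_drawdown_mean_convolution:
  assumes [measurable]: "\<phi> \<in> borel_measurable borel" "\<psi> \<in> borel_measurable borel"
    and \<phi>: "\<And>x. \<bar>\<phi> x\<bar> \<le> A" and \<psi>: "\<And>x. \<bar>\<psi> x\<bar> \<le> B"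
  shows "max_drawdown_mean \<phi> \<psi> n = (\<Sum>k\<le>n. record_mean \<phi> k * nonpos_mean \<psi> (n - k))"
proof -
  have A: "0 \<le> A" using \<phi>[of undefined] by linarith
  have B: "0 \<le> B" using \<psi>[of undefined] by linarith
  let ?\<alpha> = "\<lambda>k y. \<phi> (walk y k) * of_bool (strict_record y k)"
  let ?\<beta> = "\<lambda>m y. \<psi> (walk y m) * of_bool (stays_nonpos y m)"
  have m\<alpha> [measurable]: "?\<alpha> k \<in> borel_measurable (steps_law k)" for k by measurable
  have m\<beta> [measurable]: "?\<beta> k \<in> borel_measurable (steps_law k)" for k by measurable
  have b\<alpha>: "\<bar>?\<alpha> k y\<bar> \<le> A" for k y using \<phi>[of "walk y k"] A by auto
  have b\<beta>: "\<bar>?\<beta> k y\<bar> \<le> B" for k y using \<psi>[of "walk y k"] B by auto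
  let ?g = "\<lambda>k y. ?\<alpha> k (restrict y {..<k}) * ?\<beta> (n - k) (future_steps k (n - k) y)"
  have int: "integrable (steps_law n) (?g k)" if "k \<le> n" for k
  proof (rule integrable_steps_law_bounded[where B="A * B"])
    have [measurable]: "(\<lambda>y. restrict y {..<k}) \<in> measurable (steps_law n) (steps_law k)"
      using that by (intro measurable_restrict_subset) auto
    have [measurable]: "future_steps k (n - k) \<in> measurable (steps_law n) (steps_law (n - k))"
      using that by (intro measurable_future_steps) auto
    show "?g k \<in> borel_measurable (steps_law n)" by measurable
    show "\<bar>?g k y\<bar> \<le> A * B" for y
      unfolding abs_mult[of "?\<alpha> k (restrict y {..<k})"] by (intro mult_mono b\<alpha> b\<beta> A) auto
  qed
  have "max_drawdown_mean \<phi> \<psi> n = (LINT y|steps_law n. (\<Sum>k\<le>n. ?g k y))"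
    unfolding max_drawdown_mean_def
  proof (intro Bochner_Integration.integral_cong refl)
    fix y
    show "\<phi> (walk_max y n) * \<psi> (walk y n - walk_max y n) = (\<Sum>k\<le>n. ?g k y)"
      \<comment> \<open>The displacement after time \<open>k\<close> is the end value of the walk made of the future steps.\<close>
      unfolding first_maximum_decomposition[of "\<lambda>s. \<phi> s * \<psi> (walk y n - s)" y n]
      by (intro sum.cong refl) (simp add: walk_restrict strict_record_restrict walk_future_steps)
  qed
  also have "\<dots> = (\<Sum>k\<le>n. LINT y|steps_law n. ?g k y)"
    by (intro Bochner_Integration.integral_sum int) simp
  also have "\<dots> = (\<Sum>k\<le>n. record_mean \<phi> k * nonpos_mean \<psi> (n - k))"
  proof (intro sum.cong refl)
    fix k assume "k \<in> {..n}"
    then have n: "steps_law n = steps_law (k + (n - k))" by simp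
    show "(LINT y|steps_law n. ?g k y) = record_mean \<phi> k * nonpos_mean \<psi> (n - k)"
      unfolding record_mean_def nonpos_mean_def n
      by (rule integral_past_times_future[OF m\<alpha> m\<beta> b\<alpha> b\<beta>])
  qed
  finally show ?thesis .
qed

text \<open>Duality: reversing the steps preserves their law and turns the distance to the maximum
  into the minimum.\<close>

lemma drawdown_mean_eq_min_mean:
  assumes [measurable]: "\<psi> \<in> borel_measurable borel"
  shows "max_drawdown_mean (\<lambda>_. 1) \<psi> n = (LINT y|steps_law n. \<psi> (walk_min y n))"
  using integral_reverse_steps[of "\<lambda>y. \<psi> (walk_min y n)" n]
  by (simp add: max_drawdown_mean_def walk_min_reverse_steps)

end

text \<open>The expectation of \<open>c\<close> at a geometric time on \<open>{0, 1, 2, \<dots>}\<close> with continuation probability \<open>r\<close>.\<close>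

definition abel_mean :: "real \<Rightarrow> (nat \<Rightarrow> real) \<Rightarrow> real" where
  "abel_mean r c = (1 - r) * (\<Sum>n. r ^ n * c n)"

lemma summable_abel:
  fixes c :: "nat \<Rightarrow> real"
  assumes "0 < r" "r < 1" "\<And>n. \<bar>c n\<bar> \<le> B"
  shows "summable (\<lambda>n. norm (r ^ n * c n))"
proof (rule summable_comparison_test')
  show "summable (\<lambda>n. r ^ n * B)" using assms by (intro summable_mult2 summable_geometric) auto
  show "norm (norm (r ^ n * c n)) \<le> r ^ n * B" if "n \<ge> 0" for n
    using assms by (simp add: abs_mult mult_left_mono)
qed

text \<open>The exponential time, rounded up to the grid, is geometric on \<open>{1, 2, \<dots>}\<close> rather than
  \<open>{0, 1, \<dots>}\<close>; the two Abel means differ by a term that vanishes as \<open>r\<close> tends to \<open>1\<close>.\<close>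

lemma abel_mean_split_head:
  fixes c :: "nat \<Rightarrow> real"
  assumes r: "0 < r" "r < 1" and c: "\<And>n. \<bar>c n\<bar> \<le> B"
  shows "abel_mean r c = (1 - r) * c 0 + r * abel_mean r (\<lambda>n. c (Suc n))"
proof -
  have "summable (\<lambda>n. r ^ n * c n)" using summable_abel[OF r c] by (rule summable_norm_cancel)
  then have "(\<Sum>n. r ^ n * c n) = c 0 + (\<Sum>n. r ^ Suc n * c (Suc n))"
    using suminf_split_head[of "\<lambda>n. r ^ n * c n"] by simp
  also have "(\<Sum>n. r ^ Suc n * c (Suc n)) = r * (\<Sum>n. r ^ n * c (Suc n))"
    using summable_norm_cancel[OF summable_abel[OF r, of "\<lambda>n. c (Suc n)" B]] c
    by (subst suminf_mult[symmetric]) (auto simp: mult.assoc)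
  finally show ?thesis by (simp add: abel_mean_def algebra_simps)
qed

text \<open>At a geometric time, the maximum and the distance to it are independent. The weights \<open>r ^ n\<close> turn
  the convolution into a product of a factor \<open>R \<phi>\<close> and a factor \<open>N \<psi>\<close> by the Cauchy product, and
  the constants needed to recognize the two marginal expectations cancel
  because total mass one gives \<open>(1 - r) * R 1 * N 1 = 1\<close>.\<close>

lemma (in iid_steps) wiener_hopf_geometric:
  assumes [measurable]: "\<phi> \<in> borel_measurable borel" "\<psi> \<in> borel_measurable borel"
    and \<phi>: "\<And>x. \<bar>\<phi> x\<bar> \<le> A" and \<psi>: "\<And>x. \<bar>\<psi> x\<bar> \<le> B" and r: "0 < r" "r < 1"
  shows "abel_mean r (max_drawdown_mean \<phi> \<psi>) =
    abel_mean r (max_drawdown_mean \<phi> (\<lambda>_. 1)) * abel_mean r (max_drawdown_mean (\<lambda>_. 1) \<psi>)"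
proof -
  define R where "R \<phi> = (\<Sum>k. r ^ k * record_mean \<phi> k)" for \<phi>
  define N where "N \<psi> = (\<Sum>k. r ^ k * nonpos_mean \<psi> k)" for \<psi>
  have key: "abel_mean r (max_drawdown_mean \<phi> \<psi>) = (1 - r) * R \<phi> * N \<psi>"
    if [measurable]: "\<phi> \<in> borel_measurable borel" "\<psi> \<in> borel_measurable borel"
      and \<phi>: "\<And>x. \<bar>\<phi> x\<bar> \<le> A" and \<psi>: "\<And>x. \<bar>\<psi> x\<bar> \<le> B" for \<phi> \<psi> A B
  proof -
    have A: "0 \<le> A" using \<phi>[of undefined] by linarith
    have B: "0 \<le> B" using \<psi>[of undefined] by linarith
    have "\<bar>record_mean \<phi> k\<bar> \<le> A" for k
      unfolding record_mean_def
    proof (rule prob_space.abs_integral_le[OF prob_space_steps_law])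
      show "\<bar>\<phi> (walk y k) * of_bool (strict_record y k)\<bar> \<le> A" for y
        using \<phi>[of "walk y k"] A by auto
    qed measurable
    then have sR: "summable (\<lambda>k. norm (r ^ k * record_mean \<phi> k))" by (rule summable_abel[OF r])
    have "\<bar>nonpos_mean \<psi> k\<bar> \<le> B" for k
      unfolding nonpos_mean_def
    proof (rule prob_space.abs_integral_le[OF prob_space_steps_law])
      show "\<bar>\<psi> (walk y k) * of_bool (stays_nonpos y k)\<bar> \<le> B" for y
        using \<psi>[of "walk y k"] B by auto
    qed measurable
    then have sN: "summable (\<lambda>k. norm (r ^ k * nonpos_mean \<psi> k))" by (rule summable_abel[OF r])
    have "R \<phi> * N \<psi> = (\<Sum>n. \<Sum>k\<le>n. (r ^ k * record_mean \<phi> k) * (r ^ (n - k) * nonpos_mean \<psi> (n - k)))"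
      unfolding R_def N_def by (rule Cauchy_product[OF sR sN])
    also have "\<dots> = (\<Sum>n. r ^ n * max_drawdown_mean \<phi> \<psi> n)"
    proof (intro suminf_cong)
      fix n
      have "(\<Sum>k\<le>n. (r ^ k * record_mean \<phi> k) * (r ^ (n - k) * nonpos_mean \<psi> (n - k)))
          = (\<Sum>k\<le>n. r ^ n * (record_mean \<phi> k * nonpos_mean \<psi> (n - k)))"
      proof (intro sum.cong refl)
        fix k assume "k \<in> {..n}"
        then have "r ^ n = r ^ k * r ^ (n - k)" by (simp flip: power_add)
        then show "(r ^ k * record_mean \<phi> k) * (r ^ (n - k) * nonpos_mean \<psi> (n - k))
            = r ^ n * (record_mean \<phi> k * nonpos_mean \<psi> (n - k))" by simp
      qed
      then show "(\<Sum>k\<le>n. (r ^ k * record_mean \<phi> k) * (r ^ (n - k) * nonpos_mean \<psi> (n - k)))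
          = r ^ n * max_drawdown_mean \<phi> \<psi> n"
        using max_drawdown_mean_convolution[of \<phi> \<psi> A B n] \<phi> \<psi> that by (simp add: sum_distrib_left)
    qed
    finally show ?thesis by (simp add: abel_mean_def)
  qed
  have "max_drawdown_mean (\<lambda>_. 1) (\<lambda>_. 1) n = 1" for n
    using prob_space.prob_space[OF prob_space_steps_law[of n]] by (simp add: max_drawdown_mean_def)
  then have "abel_mean r (max_drawdown_mean (\<lambda>_. 1) (\<lambda>_. 1)) = 1"
    using r by (simp add: abel_mean_def suminf_geometric)
  then have one: "(1 - r) * R (\<lambda>_. 1) * N (\<lambda>_. 1) = 1"
    using key[of "\<lambda>_. 1" "\<lambda>_. 1" 1 1] by simp
  have "abel_mean r (max_drawdown_mean \<phi> (\<lambda>_. 1)) * abel_mean r (max_drawdown_mean (\<lambda>_. 1) \<psi>)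
      = ((1 - r) * R \<phi> * N \<psi>) * ((1 - r) * R (\<lambda>_. 1) * N (\<lambda>_. 1))"
    using key[of \<phi> "\<lambda>_. 1" A 1] key[of "\<lambda>_. 1" \<psi> 1 B] \<phi> \<psi> by simp
  then show ?thesis using key[of \<phi> \<psi> A B] \<phi> \<psi> one by simp
qed

section \<open>Laplace transforms on the right half-plane\<close>

lemma norm_exp_minus_one_le: "norm (exp w - 1) \<le> norm w * exp (norm w)" for w :: complex
  using Taylor_exp_field[of w 0] by (simp add: mult.commute)

lemma integrable_exp_decay:
  assumes "0 < (a::real)"
  shows "set_integrable lborel {0<..} (\<lambda>t. exp (- a * t))"
proof -
  interpret prob_space "density lborel (exponential_density a)"
    using assms by (rule prob_space_exponential_density)
  have "integrable (density lborel (exponential_density a)) (\<lambda>t. 1 :: real)" by simp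
  then have "integrable lborel (\<lambda>t. exponential_density a t * 1)"
    using assms by (subst (asm) integrable_density) (auto simp: exponential_density_nonneg)
  then have "set_integrable lborel {0<..} (\<lambda>t. exponential_density a t / a)"
    unfolding set_integrable_def by (intro integrable_mult_indicator) auto
  then show ?thesis
    by (rule set_integrable_cong[THEN iffD1, rotated 3]) (use assms in \<open>auto simp: exponential_density_def mult.commute\<close>)
qed

text \<open>Differentiation under the integral. For increments \<open>h\<close> of modulus below a quarter of \<open>a = Re z\<close> the
  difference quotient of the kernel is at most \<open>t * exp (a / 4 * t) * exp (- a * t)\<close> in modulus, and bounding the
  factor \<open>t\<close> by another exponential leaves an integrable majorant \<open>exp (- (a / 2) * t)\<close> up to a constant.\<close>

lemma laplace_transform_holomorphic:
  fixes c :: "real \<Rightarrow> real"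
  assumes [measurable]: "c \<in> borel_measurable borel" and c: "\<And>t. \<bar>c t\<bar> \<le> B"
  shows "(\<lambda>z. CLINT t:{0<..}|lborel. exp (- z * of_real t) * of_real (c t)) holomorphic_on {z. 0 < Re z}"
proof -
  let ?I = "\<lambda>t::real. indicator {0<..} t :: real"
  let ?g = "\<lambda>z t. ?I t *\<^sub>R (exp (- z * complex_of_real t) * complex_of_real (c t))"
  have B: "0 \<le> B" using c[of 0] by linarith
  have int: "integrable lborel (?g z)" if "0 < Re z" for z
  proof (rule Bochner_Integration.integrable_bound)
    show "integrable lborel (\<lambda>t. B * (?I t *\<^sub>R exp (- Re z * t)))"
      using integrable_exp_decay[OF that] unfolding set_integrable_def by (intro integrable_mult_right)
    have "norm (?g z t) \<le> norm (B * (?I t *\<^sub>R exp (- Re z * t)))" for t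
      using c[of t] B by (auto simp: norm_mult indicator_def mult.commute[of B] intro!: mult_left_mono)
    then show "AE t in lborel. norm (?g z t) \<le> norm (B * (?I t *\<^sub>R exp (- Re z * t)))" by simp
  qed measurable
  have "\<exists>D. ((\<lambda>z. integral\<^sup>L lborel (?g z)) has_field_derivative D) (at z)" if z: "0 < Re z" for z
  proof -
    define a where "a = Re z"
    define D where "D = (LINT t|lborel. ?I t *\<^sub>R (- of_real t * exp (- z * of_real t) * complex_of_real (c t)))"
    define S where "S = ball (0::complex) (a / 4)"
    have a: "0 < a" using z by (simp add: a_def)
    have "((\<lambda>h. (integral\<^sup>L lborel (?g (z + h)) - integral\<^sup>L lborel (?g z)) / h) \<longlongrightarrow> D) (at 0 within S)"
      unfolding tendsto_at_iff_sequentially comp_def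
    proof (intro allI impI)
      fix h :: "nat \<Rightarrow> complex" assume h: "\<forall>i. h i \<in> S - {0}" "h \<longlonglongrightarrow> 0"
      have h0: "h i \<noteq> 0" and hn: "norm (h i) < a / 4" for i using h(1) by (auto simp: S_def)
      have hR: "0 < Re (z + h i)" for i
        using hn[of i] abs_Re_le_cmod[of "h i"] a unfolding a_def by simp
      let ?q = "\<lambda>i t. ?I t *\<^sub>R (exp (- z * of_real t) * ((exp (- h i * of_real t) - 1) / h i) * complex_of_real (c t))"
      have eq: "(?g (z + h i) t - ?g z t) / h i = ?q i t" for i t
        by (simp add: scaleR_conv_of_real algebra_simps exp_add[symmetric] diff_divide_distrib add_divide_distrib)
      have "(\<lambda>i. integral\<^sup>L lborel (?q i)) \<longlonglongrightarrow> D"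
        unfolding D_def
      proof (rule integral_dominated_convergence)
        show "integrable lborel (\<lambda>t. B * (4 / a) * (?I t *\<^sub>R exp (- (a / 2) * t)))"
          using integrable_exp_decay[of "a / 2"] a unfolding set_integrable_def by (intro integrable_mult_right) auto
        have "(\<lambda>i. ?q i t) \<longlonglongrightarrow> ?I t *\<^sub>R (- of_real t * exp (- z * of_real t) * complex_of_real (c t))" for t
        proof -
          have "((\<lambda>x. exp (- x * of_real t)) has_field_derivative - of_real t) (at (0::complex))"
            by (auto intro!: derivative_eq_intros)
          then have "((\<lambda>x. (exp (- x * of_real t) - 1) / x) \<longlongrightarrow> - of_real t) (at (0::complex))"
            by (simp add: has_field_derivative_iff)
          moreover have "filterlim h (at 0) sequentially"
            using h h0 by (auto simp: filterlim_at)
          ultimately have "(\<lambda>i. (exp (- h i * of_real t) - 1) / h i) \<longlonglongrightarrow> - of_real t"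
            by (rule filterlim_compose)
          then have "(\<lambda>i. ?q i t) \<longlonglongrightarrow> ?I t *\<^sub>R (exp (- z * of_real t) * (- of_real t) * complex_of_real (c t))"
            by (intro tendsto_intros)
          then show ?thesis by (simp add: mult.commute)
        qed
        then show "AE t in lborel. (\<lambda>i. ?q i t) \<longlonglongrightarrow> ?I t *\<^sub>R (- of_real t * exp (- z * of_real t) * complex_of_real (c t))"
          by simp
        have "norm (?q i t) \<le> B * (4 / a) * (?I t *\<^sub>R exp (- (a / 2) * t))" for i t
        proof (cases "0 < t")
          case True
          have "norm ((exp (- h i * of_real t) - 1) / h i) \<le> t * exp (a / 4 * t)"
          proof -
            have "norm (exp (- h i * of_real t) - 1) \<le> norm (h i) * t * exp (norm (h i) * t)"
              using norm_exp_minus_one_le[of "- h i * of_real t"] True by (simp add: norm_mult)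
            also have "\<dots> \<le> norm (h i) * t * exp (a / 4 * t)"
              using hn[of i] True by (intro mult_left_mono) auto
            finally show ?thesis using h0[of i] by (simp add: norm_divide divide_le_eq mult_ac)
          qed
          also have "\<dots> \<le> (4 / a) * exp (a / 4 * t) * exp (a / 4 * t)"
          proof (intro mult_right_mono)
            have "a / 4 * t \<le> exp (a / 4 * t)" using exp_ge_add_one_self[of "a / 4 * t"] by linarith
            then show "t \<le> 4 / a * exp (a / 4 * t)" using a by (simp add: field_simps)
          qed auto
          also have "\<dots> = (4 / a) * exp (a / 2 * t)" by (simp add: mult.assoc flip: exp_add)
          finally have 1: "norm ((exp (- h i * of_real t) - 1) / h i) \<le> (4 / a) * exp (a / 2 * t)" .
          have "norm (?q i t) = exp (- a * t) * norm ((exp (- h i * of_real t) - 1) / h i) * \<bar>c t\<bar>"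
            unfolding norm_scaleR norm_mult using True by (simp add: a_def)
          also have "\<dots> \<le> exp (- a * t) * ((4 / a) * exp (a / 2 * t)) * B"
            using 1 c[of t] a by (intro mult_mono mult_nonneg_nonneg) auto
          also have "\<dots> = B * (4 / a) * exp (- (a / 2) * t)"
          proof -
            have "exp (- (a / 2) * t) = exp (- a * t) * exp (a / 2 * t)" by (simp flip: exp_add)
            then show ?thesis by simp
          qed
          finally show ?thesis using True by simp
        qed simp
        then show "AE t in lborel. norm (?q i t) \<le> B * (4 / a) * (?I t *\<^sub>R exp (- (a / 2) * t))" for i
          by simp
      qed measurable
      moreover have "(integral\<^sup>L lborel (?g (z + h i)) - integral\<^sup>L lborel (?g z)) / h i = integral\<^sup>L lborel (?q i)" for i
        unfolding eq[symmetric] using int[OF hR[of i]] int[OF z] by (subst integral_divide_zero) simp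
      ultimately show "(\<lambda>i. (integral\<^sup>L lborel (?g (z + h i)) - integral\<^sup>L lborel (?g z)) / h i) \<longlonglongrightarrow> D"
        by simp
    qed
    moreover have "at 0 within S = at (0::complex)"
      using a by (intro at_within_open) (auto simp: S_def)
    ultimately have "((\<lambda>z. integral\<^sup>L lborel (?g z)) has_field_derivative D) (at z)"
      by (simp only: DERIV_def)
    then show ?thesis ..
  qed
  then show ?thesis
    unfolding set_lebesgue_integral_def
    by (intro holomorphic_onI) (auto simp: field_differentiable_def intro: has_field_derivative_at_within)
qed

text \<open>The factor \<open>p\<close> is the normalization of the exponential density.\<close>

lemma continues_laplace_transform:
  fixes c :: "real \<Rightarrow> real"
  assumes c: "c \<in> borel_measurable borel" "\<And>t. \<bar>c t\<bar> \<le> B"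
    and h: "\<And>p. 0 < p \<Longrightarrow> h p = p * (LINT t:{0<..}|lborel. exp (- p * t) * c t)"
  shows "continues_to_right_half_plane h"
  unfolding continues_to_right_half_plane_def
proof (intro exI[of _ "\<lambda>z. z * (CLINT t:{0<..}|lborel. exp (- z * of_real t) * of_real (c t))"] conjI allI impI)
  have "open {z. 0 < Re z}" by (rule open_halfspace_Re_gt)
  then show "(\<lambda>z. z * (CLINT t:{0<..}|lborel. exp (- z * of_real t) * of_real (c t))) analytic_on {z. 0 < Re z}"
    by (subst analytic_on_open) (assumption, intro holomorphic_intros laplace_transform_holomorphic[OF c])
next
  fix p :: real assume "0 < p"
  have "(CLINT t:{0<..}|lborel. exp (- complex_of_real p * of_real t) * of_real (c t))
      = complex_of_real (LINT t:{0<..}|lborel. exp (- p * t) * c t)"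
    by (simp add: exp_of_real flip: set_integral_complex_of_real of_real_mult of_real_minus)
  then show "complex_of_real p * (CLINT t:{0<..}|lborel. exp (- complex_of_real p * of_real t) * of_real (c t))
      = complex_of_real (h p)"
    using \<open>0 < p\<close> by (simp add: h)
qed

section \<open>Increments and grid approximation of a Levy process\<close>

text \<open>On a complete measure space a function that agrees almost everywhere with a measurable one is
  itself measurable. The running extrema agree with measurable functions only outside a null set.\<close>

lemma (in complete_measure) measurable_AE_eq:
  assumes f: "f \<in> measurable M N" and eq: "AE x in M. f x = g x" and g: "g \<in> space M \<rightarrow> space N"
  shows "g \<in> measurable M N"
proof (rule measurableI)
  fix A assume "A \<in> sets N"
  then have "f -` A \<inter> space M \<in> sets M" using f by (rule measurable_sets[rotated])
  moreover have "AE x in M. x \<in> f -` A \<inter> space M \<longleftrightarrow> x \<in> g -` A \<inter> space M"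
    using eq by eventually_elim auto
  ultimately show "g -` A \<inter> space M \<in> sets M" using in_sets_AE by blast
qed (use g in auto)

context levy_process
begin

lemma measurable_X_F: "0 \<le> s \<Longrightarrow> s \<le> t \<Longrightarrow> X s \<in> borel_measurable (F t)"
  using adapted[of s] F_mono[of s t] subalgebra_F[of s] subalgebra_F[of t]
  unfolding measurable_def subalgebra_def by fastforce

lemma measurable_X: "0 \<le> t \<Longrightarrow> X t \<in> borel_measurable M"
  using adapted[of t] subalgebra_F[of t] by (rule measurable_from_subalg[rotated])

definition increment :: "real \<Rightarrow> nat \<Rightarrow> 'a \<Rightarrow> real" where
  "increment h i \<omega> = X (real (Suc i) * h) \<omega> - X (real i * h) \<omega>"

lemma measurable_increment_F:
  "0 \<le> h \<Longrightarrow> i < n \<Longrightarrow> increment h i \<in> borel_measurable (F (real n * h))"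
  unfolding increment_def[abs_def]
  by (intro borel_measurable_diff measurable_X_F mult_right_mono) auto

lemma measurable_increment: "0 \<le> h \<Longrightarrow> increment h i \<in> borel_measurable M"
  unfolding increment_def[abs_def]
  by (intro borel_measurable_diff measurable_X) auto

text \<open>Induction over the steps: the first \<open>n\<close> increments are known at time \<open>n * h\<close>, and the next one is
  independent of that past with the law of \<open>X h\<close>.\<close>

lemma prob_increments_product:
  assumes h: "0 \<le> h" and A: "\<And>i. A i \<in> sets borel"
  shows "{\<omega>\<in>space M. \<forall>i<n. increment h i \<omega> \<in> A i} \<in> sets (F (real n * h)) \<and>
    prob {\<omega>\<in>space M. \<forall>i<n. increment h i \<omega> \<in> A i} = (\<Prod>i<n. measure (distr M borel (X h)) (A i))"
proof (induction n)
  case 0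
  have "space M \<in> sets (F 0)" using subalgebra_F[of 0] sets.top[of "F 0"] by (auto simp: subalgebra_def)
  then show ?case by (simp add: prob_space)
next
  case (Suc n)
  let ?E = "{\<omega>\<in>space M. \<forall>i<n. increment h i \<omega> \<in> A i}"
  let ?D = "increment h n -` A n \<inter> space M"
  have E_split: "{\<omega>\<in>space M. \<forall>i<Suc n. increment h i \<omega> \<in> A i} = ?E \<inter> ?D"
    by (auto simp: less_Suc_eq)
  have ord: "0 \<le> real n * h" "real n * h \<le> real (Suc n) * h" using h by (auto simp: mult_right_mono)
  have spF: "space (F (real (Suc n) * h)) = space M"
    using subalgebra_F[of "real (Suc n) * h"] h by (simp add: subalgebra_def)
  have E_sets: "?E \<in> sets (F (real (Suc n) * h))" using Suc F_mono[OF ord] by (meson subsetD)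
  have D_sets: "?D \<in> sets (F (real (Suc n) * h))"
    using measurable_sets[OF measurable_increment_F[OF h, of n "Suc n"] A[of n]] spF by simp
  have E_D: "prob (?E \<inter> ?D) = prob ?E * prob ?D"
  proof (rule indep_setD)
    show "indep_set (sets (F (real n * h)))
        (sets (vimage_algebra (space M) (\<lambda>\<omega>. X (real (Suc n) * h) \<omega> - X (real n * h) \<omega>) borel))"
      using ord by (rule independent_increments)
    show "?D \<in> sets (vimage_algebra (space M) (\<lambda>\<omega>. X (real (Suc n) * h) \<omega> - X (real n * h) \<omega>) borel)"
      using in_vimage_algebra[OF A[of n], of "increment h n" "space M"] unfolding increment_def[abs_def] .
    show "?E \<in> sets (F (real n * h))" using Suc by (rule conjunct1)
  qed
  have D_prob: "prob ?D = measure (distr M borel (X h)) (A n)"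
  proof -
    have "prob ?D = measure (distr M borel (increment h n)) (A n)"
      using measure_distr[OF measurable_increment[OF h, of n] A[of n]] by simp
    also have "distr M borel (increment h n) = distr M borel (X (real (Suc n) * h - real n * h))"
      unfolding increment_def[abs_def] using ord by (rule stationary_increments)
    also have "real (Suc n) * h - real n * h = h" by (simp add: algebra_simps)
    finally show ?thesis .
  qed
  have E_prob: "prob ?E = (\<Prod>i<n. measure (distr M borel (X h)) (A i))" using Suc by (rule conjunct2)
  show ?case
    unfolding E_split prod.lessThan_Suc
    by (rule conjI[OF sets.Int[OF E_sets D_sets]]) (simp only: E_D D_prob E_prob)
qed

definition increments :: "real \<Rightarrow> nat \<Rightarrow> 'a \<Rightarrow> nat \<Rightarrow> real" where
  "increments h n \<omega> = (\<lambda>i\<in>{..<n}. increment h i \<omega>)"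

lemma iid_steps_X: "0 \<le> h \<Longrightarrow> iid_steps (distr M borel (X h))"
  unfolding iid_steps_def iid_steps_axioms_def by (simp add: prob_space_distr measurable_X)

lemma measurable_increments:
  assumes "0 \<le> h"
  shows "increments h n \<in> measurable M (PiM {..<n} (\<lambda>_. distr M borel (X h)))"
  unfolding increments_def[abs_def]
  by (intro measurable_restrict) (use measurable_increment[OF assms] in simp)

lemma distr_increments:
  assumes h: "0 \<le> h"
  shows "distr M (PiM {..<n} (\<lambda>_. distr M borel (X h))) (increments h n)
    = PiM {..<n} (\<lambda>_. distr M borel (X h))"
proof -
  interpret \<mu>: iid_steps "distr M borel (X h)" using h by (rule iid_steps_X)
  interpret PS: product_sigma_finite "\<lambda>_::nat. distr M borel (X h)" ..
  show ?thesis
  proof (rule PS.PiM_eqI)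
    fix A assume A: "\<And>i. i \<in> {..<n} \<Longrightarrow> A i \<in> sets (distr M borel (X h))"
    \<comment> \<open>The previous lemma asks for Borel sets at every index.\<close>
    define B where "B i = (if i < n then A i else UNIV)" for i
    have B: "B i \<in> sets borel" for i using A by (auto simp: B_def)
    have eq: "increments h n -` (PiE {..<n} A) \<inter> space M = {\<omega>\<in>space M. \<forall>i<n. increment h i \<omega> \<in> B i}"
    proof -
      have "increments h n \<omega> \<in> PiE {..<n} A \<longleftrightarrow> (\<forall>i<n. increment h i \<omega> \<in> B i)" for \<omega>
        unfolding increments_def restrict_PiE_iff by (auto simp: B_def)
      then show ?thesis by blast
    qed
    have "emeasure (distr M (PiM {..<n} (\<lambda>_. distr M borel (X h))) (increments h n)) (PiE {..<n} A)
        = emeasure M {\<omega>\<in>space M. \<forall>i<n. increment h i \<omega> \<in> B i}"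
      unfolding eq[symmetric]
    proof (rule emeasure_distr[OF measurable_increments[OF h]])
      show "PiE {..<n} A \<in> sets (PiM {..<n} (\<lambda>_. distr M borel (X h)))"
        by (rule sets_PiM_I_finite) (simp, rule A)
    qed
    also have "\<dots> = ennreal (\<Prod>i<n. measure (distr M borel (X h)) (B i))"
      using conjunct2[OF prob_increments_product[OF h B, of n]] by (simp only: emeasure_eq_measure)
    also have "\<dots> = (\<Prod>i<n. emeasure (distr M borel (X h)) (B i))"
      by (simp add: \<mu>.emeasure_eq_measure prod_ennreal)
    also have "\<dots> = (\<Prod>i<n. emeasure (distr M borel (X h)) (A i))"
      by (intro prod.cong) (auto simp: B_def)
    finally show "emeasure (distr M (PiM {..<n} (\<lambda>_. distr M borel (X h))) (increments h n)) (PiE {..<n} A)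
        = (\<Prod>i<n. emeasure (distr M borel (X h)) (A i))" .
  qed auto
qed

lemma walk_increments:
  assumes "X 0 \<omega> = 0" "k \<le> n"
  shows "walk (increments h n \<omega>) k = X (real k * h) \<omega>"
proof -
  have "walk (increments h n \<omega>) k = (\<Sum>i<k. X (real (Suc i) * h) \<omega> - X (real i * h) \<omega>)"
    unfolding walk_def increments_def increment_def using assms by (intro sum.cong) auto
  also have "\<dots> = X (real k * h) \<omega>" using assms by (subst sum_lessThan_telescope) simp
  finally show ?thesis .
qed

lemma integral_increments:
  fixes g :: "(nat \<Rightarrow> real) \<Rightarrow> real"
  assumes h: "0 \<le> h" and g: "g \<in> borel_measurable (PiM {..<n} (\<lambda>_. distr M borel (X h)))"
  shows "(LINT \<omega>|M. g (increments h n \<omega>)) = (LINT y|PiM {..<n} (\<lambda>_. distr M borel (X h)). g y)"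
  using integral_distr[OF measurable_increments[OF h] g] unfolding distr_increments[OF h] by simp

definition grid_triple :: "nat \<Rightarrow> nat \<Rightarrow> 'a \<Rightarrow> real \<times> real \<times> real" where
  "grid_triple N n \<omega> = (X (real n * mesh N) \<omega>, (MAX k\<in>{..n}. X (real k * mesh N) \<omega>), (MIN k\<in>{..n}. X (real k * mesh N) \<omega>))"

text \<open>The process and its two extrema are bundled so that measurability and the passage to the limit
  are treated once.\<close>

definition triple :: "real \<Rightarrow> 'a \<Rightarrow> real \<times> real \<times> real" where
  "triple t \<omega> = (X t \<omega>, running_sup X t \<omega>, running_inf X t \<omega>)"

text \<open>The \<open>\<sigma>\<close>-algebra is left open because the same grid values are needed both for \<open>M\<close> and for the
  \<open>\<sigma>\<close>-algebra generated by the paths alone.\<close>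

lemma measurable_grid_triple_of:
  assumes "\<And>t. 0 \<le> t \<Longrightarrow> X t \<in> borel_measurable N'"
  shows "grid_triple N n \<in> borel_measurable N'"
  unfolding grid_triple_def[abs_def]
  by (intro borel_measurable_Pair borel_measurable_Max borel_measurable_Min assms)
     (auto simp: mesh_pos less_imp_le)

lemmas measurable_grid_triple [measurable] = measurable_grid_triple_of[OF measurable_X]

text \<open>On the grid the process is a random walk whose steps have the law of \<open>X (mesh N)\<close>, almost surely
  because the process starts at \<open>0\<close> only almost surely. The second formula uses duality.\<close>

lemma integral_grid_triple_wiener_hopf:
  assumes [measurable]: "\<phi> \<in> borel_measurable borel" "\<psi> \<in> borel_measurable borel"
  shows "(LINT \<omega>|M. (\<lambda>(x, s, i). \<phi> s * \<psi> (x - s)) (grid_triple N n \<omega>))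
      = iid_steps.max_drawdown_mean (distr M borel (X (mesh N))) \<phi> \<psi> n" (is ?A)
    and "(LINT \<omega>|M. (\<lambda>(x, s, i). \<psi> i) (grid_triple N n \<omega>))
      = iid_steps.max_drawdown_mean (distr M borel (X (mesh N))) (\<lambda>_. 1) \<psi> n" (is ?B)
proof -
  let ?h = "mesh N"
  have h: "0 \<le> ?h" using mesh_pos[of N] by simp
  interpret \<mu>: iid_steps "distr M borel (X ?h)" using h by (rule iid_steps_X)
  note [measurable] = measurable_increments[OF h]
  have ae: "AE \<omega> in M. grid_triple N n \<omega> =
      (walk (increments ?h n \<omega>) n, walk_max (increments ?h n \<omega>) n, walk_min (increments ?h n \<omega>) n)"
    using start_zero
  proof eventually_elim
    case (elim \<omega>)
    have "walk (increments ?h n \<omega>) ` {..n} = (\<lambda>k. X (k * ?h) \<omega>) ` {..n}"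
      by (intro image_cong) (auto simp: walk_increments[OF elim])
    then show ?case by (simp add: grid_triple_def walk_max_def walk_min_def walk_increments[OF elim])
  qed
  have [measurable]: "(\<lambda>y. walk y n) \<in> borel_measurable (\<mu>.steps_law n)" by measurable
  let ?g = "\<lambda>(x, s, i :: real). \<phi> s * \<psi> (x - s)" and ?g' = "\<lambda>y. \<phi> (walk_max y n) * \<psi> (walk y n - walk_max y n)"
  have g: "?g \<in> borel_measurable borel" unfolding borel_prod[symmetric] by measurable
  have g': "?g' \<in> borel_measurable (\<mu>.steps_law n)" by measurable
  have "(LINT \<omega>|M. ?g (grid_triple N n \<omega>)) = (LINT \<omega>|M. ?g' (increments ?h n \<omega>))"
  proof (rule integral_cong_AE)
    show "AE \<omega> in M. ?g (grid_triple N n \<omega>) = ?g' (increments ?h n \<omega>)"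
      using ae by eventually_elim simp
    show "(\<lambda>\<omega>. ?g (grid_triple N n \<omega>)) \<in> borel_measurable M"
      by (rule measurable_compose[OF measurable_grid_triple g])
    show "(\<lambda>\<omega>. ?g' (increments ?h n \<omega>)) \<in> borel_measurable M"
      by (rule measurable_compose[OF measurable_increments[OF h] g'])
  qed
  then show ?A unfolding \<mu>.max_drawdown_mean_def integral_increments[OF h g'] .
  let ?g = "\<lambda>(x :: real, s :: real, i). \<psi> i" and ?g' = "\<lambda>y. \<psi> (walk_min y n)"
  have g: "?g \<in> borel_measurable borel" unfolding borel_prod[symmetric] by measurable
  have g': "?g' \<in> borel_measurable (\<mu>.steps_law n)" by measurable
  have "(LINT \<omega>|M. ?g (grid_triple N n \<omega>)) = (LINT \<omega>|M. ?g' (increments ?h n \<omega>))"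
  proof (rule integral_cong_AE)
    show "AE \<omega> in M. ?g (grid_triple N n \<omega>) = ?g' (increments ?h n \<omega>)"
      using ae by eventually_elim simp
    show "(\<lambda>\<omega>. ?g (grid_triple N n \<omega>)) \<in> borel_measurable M"
      by (rule measurable_compose[OF measurable_grid_triple g])
    show "(\<lambda>\<omega>. ?g' (increments ?h n \<omega>)) \<in> borel_measurable M"
      by (rule measurable_compose[OF measurable_increments[OF h] g'])
  qed
  then show ?B unfolding \<mu>.drawdown_mean_eq_min_mean[OF assms(2)] integral_increments[OF h g'] .
qed

lemma grid_triple_tendsto:
  "AE \<omega> in M. \<forall>t\<ge>0. (\<lambda>N. grid_triple N (steps N t) \<omega>) \<longlonglongrightarrow> triple t \<omega>"
  using cadlag_paths
proof (eventually_elim, intro allI impI)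
  fix \<omega> t assume x: "cadlag (\<lambda>t. X t \<omega>)" and t: "0 \<le> (t::real)"
  show "(\<lambda>N. grid_triple N (steps N t) \<omega>) \<longlonglongrightarrow> triple t \<omega>"
    unfolding grid_triple_def triple_def running_sup_def running_inf_def
    by (intro tendsto_Pair cadlag_grid_max_tendsto[OF x t] cadlag_grid_min_tendsto[OF x t]
        cadlag_tendsto_from_right[OF x t steps_mesh_bounds(1)[OF t] steps_mesh_tendsto[OF t]])
qed

text \<open>The \<open>\<sigma>\<close>-algebra from which the exponential times are independent.\<close>

definition path_algebra :: "'a measure" where
  "path_algebra = vimage_algebra (space M) (\<lambda>\<omega>. \<lambda>t\<in>{0..}. X t \<omega>) (PiM {0..} (\<lambda>_. borel))"

lemma space_path_algebra [simp]: "space path_algebra = space M"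
  by (simp add: path_algebra_def)

lemma measurable_X_path_algebra:
  assumes "0 \<le> t"
  shows "X t \<in> borel_measurable path_algebra"
proof -
  have "(\<lambda>\<omega>. \<lambda>t\<in>{0..}. X t \<omega>) \<in> measurable path_algebra (PiM {0..} (\<lambda>_. borel))"
    unfolding path_algebra_def by (rule measurable_vimage_algebra1) (auto simp: space_PiM)
  from measurable_compose[OF this measurable_component_singleton[of t]] assms
  show ?thesis by simp
qed

lemma measurable_ident_path_algebra: "(\<lambda>\<omega>. \<omega>) \<in> measurable M path_algebra"
  unfolding path_algebra_def
  by (intro measurable_vimage_algebra2 measurable_restrict measurable_X) auto

text \<open>A version of \<open>triple\<close> that is jointly measurable in time and path. Grid values are
  jointly measurable, being built from countably many random variables, and so is their limit,
  whereas \<open>triple\<close> itself is measurable only up to null sets.\<close>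

definition triple_version :: "real \<Rightarrow> 'a \<Rightarrow> real \<times> real \<times> real" where
  "triple_version t \<omega> = lim (\<lambda>N. grid_triple N (steps N t) \<omega>)"

lemma measurable_triple_version_pair [measurable]:
  "(\<lambda>(t, \<omega>). triple_version t \<omega>) \<in> borel_measurable (borel \<Otimes>\<^sub>M path_algebra)"
proof -
  have "(\<lambda>p. grid_triple N (steps N (fst p)) (snd p)) \<in> borel_measurable (borel \<Otimes>\<^sub>M path_algebra)" for N
  proof (rule measurable_compose_countable)
    show "(\<lambda>p. grid_triple N n (snd p)) \<in> borel_measurable (borel \<Otimes>\<^sub>M path_algebra)" for n
      using measurable_grid_triple_of[OF measurable_X_path_algebra] by (rule measurable_compose[OF measurable_snd])
  qed measurable
  then show ?thesis
    unfolding triple_version_def split_beta by (rule borel_measurable_lim_metric)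
qed

lemma triple_version_eq: "AE \<omega> in M. \<forall>t\<ge>0. triple_version t \<omega> = triple t \<omega>"
  using grid_triple_tendsto unfolding triple_version_def by eventually_elim (blast intro: limI)

lemma measurable_triple_version_path: "triple_version t \<in> borel_measurable path_algebra"
proof -
  have "(\<lambda>\<omega>. (t, \<omega>)) \<in> measurable path_algebra (borel \<Otimes>\<^sub>M path_algebra)" by measurable
  from measurable_compose[OF this measurable_triple_version_pair] show ?thesis by simp
qed

lemma measurable_triple_version: "triple_version t \<in> borel_measurable M"
  using measurable_compose[OF measurable_ident_path_algebra measurable_triple_version_path] .

lemma integral_path_algebra:
  fixes u :: "'a \<Rightarrow> real"
  assumes "u \<in> borel_measurable path_algebra"
  shows "(LINT \<omega>|distr M path_algebra (\<lambda>\<omega>. \<omega>). u \<omega>) = (LINT \<omega>|M. u \<omega>)"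
  using measurable_ident_path_algebra assms by (rule integral_distr)

lemma measurable_triple:
  assumes "0 \<le> t"
  shows "triple t \<in> borel_measurable M"
proof (rule measurable_AE_eq[OF measurable_triple_version])
  show "AE \<omega> in M. triple_version t \<omega> = triple t \<omega>"
    using triple_version_eq by eventually_elim (use assms in auto)
qed auto

text \<open>Defined through the jointly measurable version, so that it is measurable in \<open>t\<close>.\<close>

definition mean_triple :: "(real \<times> real \<times> real \<Rightarrow> real) \<Rightarrow> real \<Rightarrow> real" where
  "mean_triple g t = (LINT \<omega>|M. g (triple_version t \<omega>))"

lemma mean_triple_eq:
  assumes [measurable]: "g \<in> borel_measurable borel" and t: "0 \<le> t"
  shows "mean_triple g t = (LINT \<omega>|M. g (triple t \<omega>))"
  unfolding mean_triple_def
proof (rule integral_cong_AE)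
  note [measurable] = measurable_triple_version measurable_triple[OF t]
  show "(\<lambda>\<omega>. g (triple_version t \<omega>)) \<in> borel_measurable M" by measurable
  show "(\<lambda>\<omega>. g (triple t \<omega>)) \<in> borel_measurable M" by measurable
  show "AE \<omega> in M. g (triple_version t \<omega>) = g (triple t \<omega>)"
    using triple_version_eq by eventually_elim (use t in auto)
qed

lemma abs_mean_triple_le:
  assumes [measurable]: "g \<in> borel_measurable borel" and "\<And>p. \<bar>g p\<bar> \<le> B"
  shows "\<bar>mean_triple g t\<bar> \<le> B"
  unfolding mean_triple_def
  by (rule abs_integral_le[OF measurable_compose[OF measurable_triple_version assms(1)] assms(2)])

text \<open>Fubini, with the law of the path regarded as a measure on \<open>path_algebra\<close>.\<close>

lemma measurable_mean_triple [measurable]: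
  assumes [measurable]: "g \<in> borel_measurable borel"
  shows "mean_triple g \<in> borel_measurable borel"
proof -
  let ?P = "distr M path_algebra (\<lambda>\<omega>. \<omega>)"
  interpret P: prob_space ?P by (rule prob_space_distr[OF measurable_ident_path_algebra])
  have [measurable]: "(\<lambda>(t, \<omega>). g (triple_version t \<omega>)) \<in> borel_measurable (borel \<Otimes>\<^sub>M path_algebra)"
    using measurable_compose[OF measurable_triple_version_pair assms] by (simp add: split_beta)
  have "(\<lambda>t. LINT \<omega>|?P. g (triple_version t \<omega>)) \<in> borel_measurable borel"
    by (intro P.borel_measurable_lebesgue_integral) measurable
  moreover have "(LINT \<omega>|?P. g (triple_version t \<omega>)) = mean_triple g t" for t
    unfolding mean_triple_def
    by (rule integral_path_algebra[OF measurable_compose[OF measurable_triple_version_path assms]])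
  ultimately show ?thesis by (simp add: fun_eq_iff[symmetric])
qed

text \<open>The grid values converge almost surely, hence so do expectations of bounded continuous
  functions of them.\<close>

lemma grid_mean_tendsto:
  fixes g :: "real \<times> real \<times> real \<Rightarrow> real"
  assumes g: "continuous_on UNIV g" "\<And>p. \<bar>g p\<bar> \<le> B" and t: "0 \<le> t"
  shows "(\<lambda>N. LINT \<omega>|M. g (grid_triple N (steps N t) \<omega>)) \<longlonglongrightarrow> mean_triple g t"
  unfolding mean_triple_def
proof (rule integral_dominated_convergence[where w="\<lambda>_. B"])
  have m: "g \<in> borel_measurable borel" using g(1) by (rule borel_measurable_continuous_onI)
  show "(\<lambda>\<omega>. g (triple_version t \<omega>)) \<in> borel_measurable M"
    by (rule measurable_compose[OF measurable_triple_version m])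
  show "(\<lambda>\<omega>. g (grid_triple N (steps N t) \<omega>)) \<in> borel_measurable M" for N
    by (rule measurable_compose[OF measurable_grid_triple m])
  show "AE \<omega> in M. (\<lambda>N. g (grid_triple N (steps N t) \<omega>)) \<longlonglongrightarrow> g (triple_version t \<omega>)"
    using grid_triple_tendsto triple_version_eq
  proof eventually_elim
    case (elim \<omega>)
    then have "(\<lambda>N. grid_triple N (steps N t) \<omega>) \<longlonglongrightarrow> triple_version t \<omega>" using t by auto
    then show ?case by (rule continuous_on_tendsto_compose[OF g(1)]) auto
  qed
qed (use g in auto)

end

section \<open>Evaluation at an independent exponential time\<close>

context levy_process_exp_times
begin

lemma measurable_T: "0 < q \<Longrightarrow> T q \<in> borel_measurable M"
  using distributed_measurable[OF exponential_T] by simp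

lemma T_pos:
  assumes q: "0 < q"
  shows "AE \<omega> in M. 0 < T q \<omega>"
proof -
  note [measurable] = measurable_T[OF q]
  have "prob {\<omega>\<in>space M. 0 < T q \<omega>} = 1"
    using exponential_distributedD_gt[OF exponential_T[OF q], of 0] q by simp
  then show ?thesis by (subst (asm) prob_Collect_eq_1) measurable
qed

lemma T_nonneg: "0 < q \<Longrightarrow> AE \<omega> in M. 0 \<le> T q \<omega>"
  using T_pos[of q] by (auto elim: eventually_mono)

text \<open>Independence as a product of laws. The path is represented by the identity map into
  \<open>path_algebra\<close>, so no path space is needed.\<close>

lemma distr_T_path:
  assumes q: "0 < q"
  shows "distr M (borel \<Otimes>\<^sub>M path_algebra) (\<lambda>\<omega>. (T q \<omega>, \<omega>))
    = distr M borel (T q) \<Otimes>\<^sub>M distr M path_algebra (\<lambda>\<omega>. \<omega>)"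
proof (rule pair_measure_eqI[symmetric])
  note [measurable] = measurable_T[OF q] measurable_ident_path_algebra
  interpret E: prob_space "distr M borel (T q)" by (rule prob_space_distr) simp
  interpret P: prob_space "distr M path_algebra (\<lambda>\<omega>. \<omega>)" by (rule prob_space_distr) simp
  show "sigma_finite_measure (distr M borel (T q))" ..
  show "sigma_finite_measure (distr M path_algebra (\<lambda>\<omega>. \<omega>))" ..
  show "sets (distr M borel (T q) \<Otimes>\<^sub>M distr M path_algebra (\<lambda>\<omega>. \<omega>))
      = sets (distr M (borel \<Otimes>\<^sub>M path_algebra) (\<lambda>\<omega>. (T q \<omega>, \<omega>)))"
    by (simp cong: sets_pair_measure_cong)
  fix A B assume "A \<in> sets (distr M borel (T q))" "B \<in> sets (distr M path_algebra (\<lambda>\<omega>. \<omega>))"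
  then have A: "A \<in> sets borel" and B: "B \<in> sets path_algebra" by auto
  have Bsub: "B \<subseteq> space M" using sets.sets_into_space[OF B] by simp
  have BM: "B \<in> sets M" using measurable_sets[OF measurable_ident_path_algebra B] Bsub by (simp add: Int_absorb2)
  have AM: "T q -` A \<inter> space M \<in> sets M" using A by measurable
  have "prob (B \<inter> (T q -` A \<inter> space M)) = prob B * prob (T q -` A \<inter> space M)"
    using independent_T[OF q] B in_vimage_algebra[OF A]
    by (intro indep_setD) (auto simp: path_algebra_def)
  then have "emeasure M (T q -` A \<inter> space M) * emeasure M B = emeasure M (B \<inter> (T q -` A \<inter> space M))"
    by (simp add: emeasure_eq_measure mult.commute flip: ennreal_mult)
  also have "B \<inter> (T q -` A \<inter> space M) = (\<lambda>\<omega>. (T q \<omega>, \<omega>)) -` (A \<times> B) \<inter> space M" by auto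
  finally show "emeasure (distr M borel (T q)) A * emeasure (distr M path_algebra (\<lambda>\<omega>. \<omega>)) B
      = emeasure (distr M (borel \<Otimes>\<^sub>M path_algebra) (\<lambda>\<omega>. (T q \<omega>, \<omega>))) (A \<times> B)"
    using A B Bsub by (simp add: emeasure_distr Int_absorb2)
qed

lemma measurable_triple_T:
  assumes q: "0 < q"
  shows "(\<lambda>\<omega>. triple (T q \<omega>) \<omega>) \<in> borel_measurable M"
proof (rule measurable_AE_eq)
  have "(\<lambda>\<omega>. (T q \<omega>, \<omega>)) \<in> measurable M (borel \<Otimes>\<^sub>M path_algebra)"
    using measurable_T[OF q] measurable_ident_path_algebra by measurable
  from measurable_compose[OF this measurable_triple_version_pair]
  show "(\<lambda>\<omega>. triple_version (T q \<omega>) \<omega>) \<in> borel_measurable M" by simp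
  show "AE \<omega> in M. triple_version (T q \<omega>) \<omega> = triple (T q \<omega>) \<omega>"
    using triple_version_eq T_nonneg[OF q] by eventually_elim auto
qed auto

text \<open>Independence and Fubini: sampling at the random time is averaging \<open>mean_triple\<close>
  over its law.\<close>

lemma mean_triple_T:
  assumes q: "0 < q" and g [measurable]: "g \<in> borel_measurable borel" and B: "\<And>p. \<bar>g p\<bar> \<le> B"
  shows "(LINT \<omega>|M. g (triple (T q \<omega>) \<omega>)) = (LINT \<omega>|M. mean_triple g (T q \<omega>))"
proof -
  let ?E = "distr M borel (T q)" and ?P = "distr M path_algebra (\<lambda>\<omega>. \<omega>)"
  note [measurable] = measurable_T[OF q] measurable_ident_path_algebra measurable_triple_T[OF q]
  interpret E: prob_space ?E by (rule prob_space_distr) simp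
  interpret P: prob_space ?P by (rule prob_space_distr) simp
  interpret EP: pair_prob_space ?E ?P ..
  let ?u = "\<lambda>p. g (case p of (t, \<omega>) \<Rightarrow> triple_version t \<omega>)"
  have u [measurable]: "?u \<in> borel_measurable (borel \<Otimes>\<^sub>M path_algebra)"
    using measurable_triple_version_pair by measurable
  have pair: "(\<lambda>\<omega>. (T q \<omega>, \<omega>)) \<in> measurable M (borel \<Otimes>\<^sub>M path_algebra)" by measurable
  have "(LINT \<omega>|M. g (triple (T q \<omega>) \<omega>)) = (LINT \<omega>|M. ?u (T q \<omega>, \<omega>))"
  proof (rule integral_cong_AE)
    show "(\<lambda>\<omega>. ?u (T q \<omega>, \<omega>)) \<in> borel_measurable M" using pair u by (rule measurable_compose)
    show "AE \<omega> in M. g (triple (T q \<omega>) \<omega>) = ?u (T q \<omega>, \<omega>)"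
      using triple_version_eq T_nonneg[OF q] by eventually_elim auto
  qed measurable
  also have "\<dots> = integral\<^sup>L (?E \<Otimes>\<^sub>M ?P) ?u"
    using integral_distr[OF pair u] unfolding distr_T_path[OF q] by simp
  also have "\<dots> = (LINT t|?E. LINT \<omega>|?P. ?u (t, \<omega>))"
  proof (rule EP.integral_fst'[symmetric])
    have "?u \<in> borel_measurable (?E \<Otimes>\<^sub>M ?P)" by measurable
    then show "integrable (?E \<Otimes>\<^sub>M ?P) ?u" using B by (intro EP.integrable_const_bound[of _ B]) auto
  qed
  also have "(\<lambda>t. LINT \<omega>|?P. ?u (t, \<omega>)) = mean_triple g"
    unfolding mean_triple_def
    using integral_path_algebra[OF measurable_compose[OF measurable_triple_version_path g]] by auto
  also have "(LINT t|?E. mean_triple g t) = (LINT \<omega>|M. mean_triple g (T q \<omega>))"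
    by (rule integral_distr) measurable
  finally show ?thesis .
qed

lemma integral_T_laplace:
  assumes q: "0 < q" and [measurable]: "c \<in> borel_measurable borel"
  shows "(LINT \<omega>|M. c (T q \<omega>)) = q * (LINT t:{0<..}|lborel. exp (- q * t) * c t)"
proof -
  have "(LINT \<omega>|M. c (T q \<omega>)) = (LINT t|lborel. exponential_density q t * c t)"
    using exponential_T[OF q] q by (intro distributed_integral[symmetric]) (auto simp: exponential_density_nonneg)
  also have "\<dots> = (LINT t|lborel. q * (indicator {0<..} t *\<^sub>R (exp (- q * t) * c t)))"
  proof (rule integral_cong_AE)
    \<comment> \<open>The density is positive at \<open>0\<close>, which the integral on the right excludes.\<close>
    have "AE t in lborel. t \<noteq> (0::real)" by (rule AE_lborel_singleton)
    then show "AE t in lborel. exponential_density q t * c t = q * (indicator {0<..} t *\<^sub>R (exp (- q * t) * c t))"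
      by eventually_elim (auto simp: exponential_density_def mult.commute)
  qed measurable
  finally show ?thesis by (simp add: set_lebesgue_integral_def)
qed

text \<open>The memoryless exponential time becomes geometric after rounding up to the grid.\<close>

lemma prob_steps_T:
  assumes q: "0 < q"
  shows "prob {\<omega>\<in>space M. steps N (T q \<omega>) = Suc n} = (1 - exp (- q * mesh N)) * exp (- q * mesh N) ^ n"
proof -
  note [measurable] = measurable_T[OF q]
  let ?L = "\<lambda>k. {\<omega>\<in>space M. T q \<omega> \<le> real k * mesh N}"
  have L: "prob (?L k) = 1 - exp (- q * mesh N) ^ k" for k
  proof -
    have "prob (?L k) = 1 - exp (- (real k * mesh N) * q)"
      using exponential_distributedD_le[OF exponential_T[OF q], of "real k * mesh N"] q mesh_pos[of N] by simp
    also have "exp (- (real k * mesh N) * q) = exp (- q * mesh N) ^ k"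
      by (simp add: exp_of_nat_mult[symmetric] mult_ac)
    finally show ?thesis .
  qed
  have "{\<omega>\<in>space M. steps N (T q \<omega>) = Suc n} = ?L (Suc n) - ?L n"
    unfolding steps_le_iff[symmetric] by auto
  moreover have "prob (?L (Suc n) - ?L n) = prob (?L (Suc n)) - prob (?L n)"
  proof (rule finite_measure_Diff)
    show "?L n \<subseteq> ?L (Suc n)"
      using mesh_pos[of N] by (auto intro: order_trans mult_right_mono)
  qed measurable
  ultimately show ?thesis by (simp only: L) (simp add: algebra_simps)
qed

text \<open>The values of \<open>steps\<close> partition the sample space, up to the null event that the exponential time
  is \<open>0\<close>, and the expectation is summed over this partition.\<close>

lemma integral_steps_T:
  fixes a :: "nat \<Rightarrow> real"
  assumes q: "0 < q" and a: "\<And>n. \<bar>a n\<bar> \<le> B"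
  shows "(LINT \<omega>|M. a (steps N (T q \<omega>))) = abel_mean (exp (- q * mesh N)) (\<lambda>n. a (Suc n))"
proof -
  note [measurable] = measurable_T[OF q]
  define r where "r = exp (- q * mesh N)"
  have r: "0 < r" "r < 1" using q mesh_pos[of N] by (auto simp: r_def)
  let ?A = "\<lambda>n. {\<omega>\<in>space M. steps N (T q \<omega>) = Suc n}"
  let ?f = "\<lambda>n \<omega>. a (Suc n) * indicator (?A n) \<omega>"
  have A [measurable]: "?A n \<in> sets M" for n by measurable
  have f_int: "integrable M (?f n)" for n by (intro integrable_mult_right) (simp add: emeasure_eq_measure)
  have f_integral: "(LINT \<omega>|M. ?f n \<omega>) = a (Suc n) * ((1 - r) * r ^ n)" for n
    using prob_steps_T[OF q, of N n] by (simp add: r_def Int_absorb2)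
  have f_norm: "(LINT \<omega>|M. norm (?f n \<omega>)) = \<bar>a (Suc n)\<bar> * ((1 - r) * r ^ n)" for n
    using prob_steps_T[OF q, of N n] by (simp add: abs_mult r_def Int_absorb2)
  \<comment> \<open>The only term that can be nonzero has index \<open>steps N (T q \<omega>) - 1\<close>.\<close>
  have single: "(\<lambda>n. ?f n \<omega>) = (\<lambda>n. if n = steps N (T q \<omega>) - 1 then ?f n \<omega> else 0)" for \<omega>
    by (auto simp: fun_eq_iff indicator_def)
  have sums: "(\<lambda>n. ?f n \<omega>) sums ?f (steps N (T q \<omega>) - 1) \<omega>" for \<omega>
    by (subst single) (rule sums_single)
  have "(LINT \<omega>|M. a (steps N (T q \<omega>))) = (LINT \<omega>|M. (\<Sum>n. ?f n \<omega>))"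
  proof (rule integral_cong_AE)
    show "AE \<omega> in M. a (steps N (T q \<omega>)) = (\<Sum>n. ?f n \<omega>)"
      using T_pos[OF q] AE_space
    proof eventually_elim
      case (elim \<omega>)
      then have "steps N (T q \<omega>) \<noteq> 0" using steps_le_iff[of N "T q \<omega>" 0] by auto
      then have "?f (steps N (T q \<omega>) - 1) \<omega> = a (steps N (T q \<omega>))" using elim by simp
      then show ?case using sums_unique[OF sums[of \<omega>]] by simp
    qed
  qed measurable
  also have "\<dots> = (\<Sum>n. LINT \<omega>|M. ?f n \<omega>)"
  proof (rule integral_suminf[OF f_int])
    have "summable (\<lambda>n. norm (?f n \<omega>))" for \<omega>
    proof -
      have "(\<lambda>n. norm (?f n \<omega>)) = (\<lambda>n. if n = steps N (T q \<omega>) - 1 then norm (?f n \<omega>) else 0)"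
        by (auto simp: fun_eq_iff indicator_def)
      then show ?thesis by (rule ssubst) (rule sums_summable[OF sums_single])
    qed
    then show "AE \<omega> in M. summable (\<lambda>n. norm (?f n \<omega>))" by simp
    have "summable (\<lambda>n. (1 - r) * norm (r ^ n * a (Suc n)))"
      using summable_abel[OF r, of "\<lambda>n. a (Suc n)" B] a by (intro summable_mult) auto
    then show "summable (\<lambda>n. LINT \<omega>|M. norm (?f n \<omega>))"
      unfolding f_norm using r by (simp add: abs_mult mult_ac)
  qed
  also have "\<dots> = (\<Sum>n. (1 - r) * (r ^ n * a (Suc n)))"
    unfolding f_integral by (simp add: mult_ac)
  also have "\<dots> = abel_mean r (\<lambda>n. a (Suc n))"
    unfolding abel_mean_def
    using summable_norm_cancel[OF summable_abel[OF r, of "\<lambda>n. a (Suc n)" B]] a by (intro suminf_mult) auto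
  finally show ?thesis by (simp add: r_def)
qed

text \<open>Rounding the exponential time up to the grid turns its expectation into an Abel mean over
  \<open>{1, 2, \<dots>}\<close>, and the missing term at \<open>0\<close> has weight \<open>1 - exp (- q * mesh N)\<close>, which tends to \<open>0\<close>.\<close>

lemma grid_abel_mean_tendsto:
  fixes g :: "real \<times> real \<times> real \<Rightarrow> real"
  assumes q: "0 < q" and g: "continuous_on UNIV g" "\<And>p. \<bar>g p\<bar> \<le> B"
  shows "(\<lambda>N. abel_mean (exp (- q * mesh N)) (\<lambda>n. LINT \<omega>|M. g (grid_triple N n \<omega>)))
    \<longlonglongrightarrow> (LINT \<omega>|M. g (triple (T q \<omega>) \<omega>))"
proof -
  note [measurable] = measurable_T[OF q]
  have m [measurable]: "g \<in> borel_measurable borel" using g(1) by (rule borel_measurable_continuous_onI)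
  define G where "G N n = (LINT \<omega>|M. g (grid_triple N n \<omega>))" for N n
  define r where "r N = exp (- q * mesh N)" for N
  have r: "0 < r N" "r N < 1" for N using q mesh_pos[of N] by (auto simp: r_def)
  have G: "\<bar>G N n\<bar> \<le> B" for N n
    unfolding G_def by (rule abs_integral_le[OF measurable_compose[OF measurable_grid_triple m] g(2)])
  have integral_G: "(LINT \<omega>|M. G N (steps N (T q \<omega>))) = abel_mean (r N) (\<lambda>n. G N (Suc n))" for N
    unfolding r_def using q G by (intro integral_steps_T)
  have "(\<lambda>N. LINT \<omega>|M. G N (steps N (T q \<omega>))) \<longlonglongrightarrow> (LINT \<omega>|M. mean_triple g (T q \<omega>))"
  proof (rule integral_dominated_convergence[where w="\<lambda>_. B"])
    show "(\<lambda>\<omega>. mean_triple g (T q \<omega>)) \<in> borel_measurable M" by measurable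
    show "(\<lambda>\<omega>. G N (steps N (T q \<omega>))) \<in> borel_measurable M" for N by measurable
    show "AE \<omega> in M. (\<lambda>N. G N (steps N (T q \<omega>))) \<longlonglongrightarrow> mean_triple g (T q \<omega>)"
      unfolding G_def using T_nonneg[OF q] by eventually_elim (rule grid_mean_tendsto[OF g])
  qed (use G in auto)
  then have lim: "(\<lambda>N. abel_mean (r N) (\<lambda>n. G N (Suc n))) \<longlonglongrightarrow> (LINT \<omega>|M. g (triple (T q \<omega>) \<omega>))"
    unfolding mean_triple_T[OF q m g(2)] by (simp only: integral_G)
  have "(\<lambda>N. exp (- q * mesh N)) \<longlonglongrightarrow> exp (- q * 0)"
    by (intro tendsto_intros mesh_tendsto_0)
  then have r1: "r \<longlonglongrightarrow> 1" by (simp add: r_def[abs_def])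
  have "(\<lambda>N. (1 - r N) * G N 0) \<longlonglongrightarrow> 0"
  proof (rule tendsto_0_le[where K=B])
    show "(\<lambda>N. 1 - r N) \<longlonglongrightarrow> 0" using tendsto_diff[OF tendsto_const r1, of 1] by simp
    show "\<forall>\<^sub>F N in sequentially. norm ((1 - r N) * G N 0) \<le> norm (1 - r N) * B"
      by (intro always_eventually allI) (simp add: abs_mult mult_left_mono G)
  qed
  moreover have "abel_mean (r N) (G N) = (1 - r N) * G N 0 + r N * abel_mean (r N) (\<lambda>n. G N (Suc n))" for N
    using r G by (rule abel_mean_split_head)
  ultimately have "(\<lambda>N. abel_mean (r N) (G N)) \<longlonglongrightarrow> (LINT \<omega>|M. g (triple (T q \<omega>) \<omega>))"
    using tendsto_add[OF _ tendsto_mult[OF r1 lim]] by fastforce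
  then show ?thesis by (simp only: G_def[abs_def] r_def)
qed

end

section \<open>Wiener-Hopf factorization of a Levy process\<close>

text \<open>Continuous piecewise linear functions that decrease to the indicator of a half-line.\<close>

lemma tendsto_indicator_atMost:
  fixes a x :: real
  shows "(\<lambda>k. max 0 (min 1 (1 - real k * (x - a)))) \<longlonglongrightarrow> indicator {..a} x"
proof (cases "x \<le> a")
  case True
  then have "max 0 (min 1 (1 - real k * (x - a))) = 1" for k
    by (simp add: mult_nonneg_nonpos)
  then show ?thesis using True by simp
next
  case False
  obtain m where m: "1 < real m * (x - a)" using reals_Archimedean3[of "x - a"] False by fastforce
  have "\<forall>\<^sub>F k in sequentially. max 0 (min 1 (1 - real k * (x - a))) = indicator {..a} x"
    using eventually_ge_at_top[of m]
  proof eventually_elim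
    case (elim k)
    have "real m * (x - a) \<le> real k * (x - a)" using elim False by (intro mult_right_mono) auto
    then have "min 1 (1 - real k * (x - a)) \<le> 0" using m by linarith
    then have "max 0 (min 1 (1 - real k * (x - a))) = 0" by (rule max_absorb1)
    also have "0 = indicator {..a} x" using False by simp
    finally show ?case .
  qed
  then show ?thesis by (rule tendsto_eventually)
qed

text \<open>The order on pairs is componentwise, so its principal lower sets are the lower quadrants. They are
  closed under intersection and generate the Borel sets of the plane.\<close>

lemma measure_eqI_atMost_real_pair:
  fixes P Q :: "(real \<times> real) measure"
  assumes P: "prob_space P" "sets P = sets borel" and Q: "prob_space Q" "sets Q = sets borel"
    and eq: "\<And>a b. measure P ({..a} \<times> {..b}) = measure Q ({..a} \<times> {..b})"
  shows "P = Q"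
proof -
  interpret P: prob_space P by fact
  interpret Q: prob_space Q by fact
  have box: "{..p} = {..fst p} \<times> {..snd p}" for p :: "real \<times> real"
    by (auto simp: less_eq_prod_def)
  let ?E = "range (\<lambda>p :: real \<times> real. {..p})"
  have gen: "sets (borel :: (real \<times> real) measure) = sigma_sets UNIV ?E"
    by (subst borel_eq_atMost) simp
  show ?thesis
  proof (rule measure_eqI_generator_eq[where \<Omega>=UNIV and E="?E" and A="\<lambda>n. {..(real n, real n)}"])
    show "Int_stable ?E"
    proof (rule Int_stableI)
      fix A B assume "A \<in> ?E" "B \<in> ?E"
      then obtain p r where "A = {..p}" "B = {..r}" by auto
      then have "A \<inter> B = {..(min (fst p) (fst r), min (snd p) (snd r))}"
        by (auto simp: less_eq_prod_def)
      then show "A \<inter> B \<in> ?E" by blast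
    qed
    show "emeasure P A = emeasure Q A" if "A \<in> ?E" for A
      using that eq by (auto simp: box P.emeasure_eq_measure Q.emeasure_eq_measure)
    show "(\<Union>n. {..(real n, real n)}) = UNIV"
    proof (intro equalityI subsetI UNIV_I)
      fix p :: "real \<times> real"
      obtain n where "max (fst p) (snd p) \<le> real n" using real_arch_simple by blast
      then show "p \<in> (\<Union>n. {..(real n, real n)})" by (auto simp: less_eq_prod_def intro!: exI[of _ n])
    qed
  qed (use P Q gen in auto)
qed

context levy_process_exp_times
begin

text \<open>The factorization holds for every grid walk and passes to the limit in each of the three Abel
  means.\<close>

lemma wiener_hopf_continuous:
  fixes \<phi> \<psi> :: "real \<Rightarrow> real"
  assumes q: "0 < q" and \<phi>: "continuous_on UNIV \<phi>" "\<And>x. \<bar>\<phi> x\<bar> \<le> A" and \<psi>: "continuous_on UNIV \<psi>" "\<And>x. \<bar>\<psi> x\<bar> \<le> B"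
  shows "(LINT \<omega>|M. \<phi> (running_sup X (T q \<omega>) \<omega>) * \<psi> (X (T q \<omega>) \<omega> - running_sup X (T q \<omega>) \<omega>))
    = (LINT \<omega>|M. \<phi> (running_sup X (T q \<omega>) \<omega>)) * (LINT \<omega>|M. \<psi> (running_inf X (T q \<omega>) \<omega>))"
proof -
  have m\<phi>: "\<phi> \<in> borel_measurable borel" using \<phi>(1) by (rule borel_measurable_continuous_onI)
  have m\<psi>: "\<psi> \<in> borel_measurable borel" using \<psi>(1) by (rule borel_measurable_continuous_onI)
  define law where "law N = distr M borel (X (mesh N))" for N
  define C where "C N \<phi> \<psi> = abel_mean (exp (- q * mesh N)) (iid_steps.max_drawdown_mean (law N) \<phi> \<psi>)" for N \<phi> \<psi>
  have sup_lim: "(\<lambda>N. C N \<phi> \<psi>) \<longlonglongrightarrow> (LINT \<omega>|M. (\<lambda>(x, s, i). \<phi> s * \<psi> (x - s)) (triple (T q \<omega>) \<omega>))"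
    if \<phi>: "continuous_on UNIV \<phi>" "\<And>x. \<bar>\<phi> x\<bar> \<le> A" and \<psi>: "continuous_on UNIV \<psi>" "\<And>x. \<bar>\<psi> x\<bar> \<le> B" for \<phi> \<psi> :: "real \<Rightarrow> real" and A B
  proof -
    have m: "\<phi> \<in> borel_measurable borel" "\<psi> \<in> borel_measurable borel"
      using \<phi>(1) \<psi>(1) by (auto intro: borel_measurable_continuous_onI)
    have "0 \<le> A" using \<phi>(2)[of 0] by linarith
    then have "\<bar>(\<lambda>(x, s, i). \<phi> s * \<psi> (x - s)) p\<bar> \<le> A * B" for p :: "real \<times> real \<times> real"
      using \<phi>(2) \<psi>(2) by (auto simp: abs_mult split_beta intro!: mult_mono)
    moreover have "continuous_on UNIV (\<lambda>(x :: real, s, i :: real). \<phi> s * \<psi> (x - s))"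
      unfolding split_beta
      by (intro continuous_intros continuous_on_compose2[OF \<phi>(1)] continuous_on_compose2[OF \<psi>(1)]) auto
    ultimately show ?thesis
      using grid_abel_mean_tendsto[OF q, of "\<lambda>(x, s, i). \<phi> s * \<psi> (x - s)" "A * B"]
      unfolding C_def law_def integral_grid_triple_wiener_hopf(1)[OF m] by blast
  qed
  have inf_lim: "(\<lambda>N. C N (\<lambda>_. 1) \<psi>) \<longlonglongrightarrow> (LINT \<omega>|M. (\<lambda>(x, s, i). \<psi> i) (triple (T q \<omega>) \<omega>))"
  proof -
    have "\<bar>(\<lambda>(x, s, i). \<psi> i) p\<bar> \<le> B" for p :: "real \<times> real \<times> real"
      using \<psi>(2) by (auto simp: split_beta)
    moreover have "continuous_on UNIV (\<lambda>(x :: real, s :: real, i). \<psi> i)"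
      unfolding split_beta by (intro continuous_intros continuous_on_compose2[OF \<psi>(1)]) auto
    ultimately show ?thesis
      using grid_abel_mean_tendsto[OF q, of "\<lambda>(x, s, i). \<psi> i" B]
      unfolding C_def law_def integral_grid_triple_wiener_hopf(2)[OF m\<psi> m\<psi>] by blast
  qed
  have factorization: "C N \<phi> \<psi> = C N \<phi> (\<lambda>_. 1) * C N (\<lambda>_. 1) \<psi>" for N
  proof -
    interpret \<mu>: iid_steps "law N" unfolding law_def using mesh_pos[of N] by (intro iid_steps_X) auto
    show ?thesis
      unfolding C_def using q mesh_pos[of N] by (intro \<mu>.wiener_hopf_geometric[OF m\<phi> m\<psi> \<phi>(2) \<psi>(2)]) auto
  qed
  have "(\<lambda>N. C N \<phi> \<psi>) \<longlonglongrightarrow>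
      (LINT \<omega>|M. (\<lambda>(x, s, i). \<phi> s * 1) (triple (T q \<omega>) \<omega>)) * (LINT \<omega>|M. (\<lambda>(x, s, i). \<psi> i) (triple (T q \<omega>) \<omega>))"
    unfolding factorization using sup_lim[OF \<phi>, of "\<lambda>_. 1" 1] by (intro tendsto_mult inf_lim) auto
  from LIMSEQ_unique[OF sup_lim[OF \<phi> \<psi>] this] show ?thesis by (simp add: triple_def)
qed

definition sup_law :: "real \<Rightarrow> real measure" where
  "sup_law q = distr M borel (\<lambda>\<omega>. running_sup X (T q \<omega>) \<omega>)"

definition inf_law :: "real \<Rightarrow> real measure" where
  "inf_law q = distr M borel (\<lambda>\<omega>. running_inf X (T q \<omega>) \<omega>)"

lemma measurable_at_T:
  assumes q: "0 < q"
  shows "(\<lambda>\<omega>. X (T q \<omega>) \<omega>) \<in> borel_measurable M"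
    and "(\<lambda>\<omega>. running_sup X (T q \<omega>) \<omega>) \<in> borel_measurable M"
    and "(\<lambda>\<omega>. running_inf X (T q \<omega>) \<omega>) \<in> borel_measurable M"
  using measurable_compose[OF measurable_triple_T[OF q], of fst borel]
    measurable_compose[OF measurable_triple_T[OF q], of "\<lambda>p. fst (snd p)" borel]
    measurable_compose[OF measurable_triple_T[OF q], of "\<lambda>p. snd (snd p)" borel]
  by (simp_all add: triple_def borel_prod[symmetric])

text \<open>The Wiener-Hopf factorization: at an independent exponential time the supremum and the
  distance to it are independent, and that distance is distributed like the infimum. Lower quadrants
  determine a law on the plane, and their indicators are limits of products of continuous functions.\<close>

lemma wiener_hopf:
  assumes q: "0 < q"
  shows "distr M borel (\<lambda>\<omega>. (running_sup X (T q \<omega>) \<omega>, X (T q \<omega>) \<omega> - running_sup X (T q \<omega>) \<omega>))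
    = sup_law q \<Otimes>\<^sub>M inf_law q"
proof (rule measure_eqI_atMost_real_pair)
  note [measurable] = measurable_at_T[OF q]
  let ?S = "\<lambda>\<omega>. running_sup X (T q \<omega>) \<omega>" and ?I = "\<lambda>\<omega>. running_inf X (T q \<omega>) \<omega>"
    and ?Z = "\<lambda>\<omega>. X (T q \<omega>) \<omega> - running_sup X (T q \<omega>) \<omega>"
  have SZ: "(\<lambda>\<omega>. (?S \<omega>, ?Z \<omega>)) \<in> borel_measurable M" by measurable
  interpret S: prob_space "sup_law q" unfolding sup_law_def by (rule prob_space_distr) measurable
  interpret I: prob_space "inf_law q" unfolding inf_law_def by (rule prob_space_distr) measurable
  interpret SI: pair_prob_space "sup_law q" "inf_law q" ..
  show "prob_space (distr M borel (\<lambda>\<omega>. (?S \<omega>, ?Z \<omega>)))" using SZ by (rule prob_space_distr)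
  show "prob_space (sup_law q \<Otimes>\<^sub>M inf_law q)" by (rule SI.prob_space_axioms)
  have "sets (sup_law q \<Otimes>\<^sub>M inf_law q) = sets (borel \<Otimes>\<^sub>M borel)"
    by (intro sets_pair_measure_cong) (simp_all add: sup_law_def inf_law_def)
  then show "sets (sup_law q \<Otimes>\<^sub>M inf_law q) = sets borel" unfolding borel_prod .
  fix a b :: real
  let ?\<phi> = "\<lambda>a k x. max 0 (min 1 (1 - real k * (x - a)))"
  have cont: "continuous_on UNIV (?\<phi> a k)" for a k by (intro continuous_intros)
  have bound: "\<bar>?\<phi> a k x\<bar> \<le> 1" for a k x by auto
  have meas [measurable]: "?\<phi> a k \<in> borel_measurable borel" for a k by measurable
  have "(\<lambda>k. LINT \<omega>|M. ?\<phi> a k (?S \<omega>) * ?\<phi> b k (?Z \<omega>)) \<longlonglongrightarrow> (LINT \<omega>|M. indicator {..a} (?S \<omega>) * indicator {..b} (?Z \<omega>))"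
    by (rule integral_dominated_convergence[where w="\<lambda>_. 1"])
      (measurable, auto simp: abs_mult intro!: tendsto_mult tendsto_indicator_atMost mult_le_one)
  moreover have "(\<lambda>k. LINT \<omega>|M. ?\<phi> a k (?S \<omega>)) \<longlonglongrightarrow> (LINT \<omega>|M. indicator {..a} (?S \<omega>))"
    by (rule integral_dominated_convergence[where w="\<lambda>_. 1"])
      (measurable, auto intro!: tendsto_indicator_atMost)
  moreover have "(\<lambda>k. LINT \<omega>|M. ?\<phi> b k (?I \<omega>)) \<longlonglongrightarrow> (LINT \<omega>|M. indicator {..b} (?I \<omega>))"
    by (rule integral_dominated_convergence[where w="\<lambda>_. 1"])
      (measurable, auto intro!: tendsto_indicator_atMost)
  ultimately have eq: "(LINT \<omega>|M. indicator {..a} (?S \<omega>) * indicator {..b} (?Z \<omega>))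
      = (LINT \<omega>|M. indicator {..a} (?S \<omega>)) * (LINT \<omega>|M. indicator {..b} (?I \<omega>) :: real)"
    unfolding wiener_hopf_continuous[OF q cont bound cont bound]
    by (intro LIMSEQ_unique[OF _ tendsto_mult]) 
  have pr: "(LINT \<omega>|M. indicator A (Y \<omega>) :: real) = measure (distr M borel Y) A"
    if "Y \<in> borel_measurable M" "A \<in> sets borel" for Y :: "'a \<Rightarrow> 'b :: topological_space" and A
    using that integral_distr[of Y M borel "indicator A :: _ \<Rightarrow> real"] by simp
  have "measure (distr M borel (\<lambda>\<omega>. (?S \<omega>, ?Z \<omega>))) ({..a} \<times> {..b})
      = (LINT \<omega>|M. indicator ({..a} \<times> {..b}) (?S \<omega>, ?Z \<omega>))"
    by (rule pr[OF SZ, symmetric]) (auto intro: borel_closed closed_Times)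
  also have "\<dots> = (LINT \<omega>|M. indicator {..a} (?S \<omega>) * indicator {..b} (?Z \<omega>))"
    by (simp add: indicator_times)
  also have "\<dots> = measure (sup_law q) {..a} * measure (inf_law q) {..b}"
    unfolding eq sup_law_def inf_law_def by (subst (1 2) pr) auto
  also have "\<dots> = measure (sup_law q \<Otimes>\<^sub>M inf_law q) ({..a} \<times> {..b})"
    unfolding measure_def
    by (subst I.emeasure_pair_measure_Times) (auto simp: sup_law_def inf_law_def enn2real_mult)
  finally show "measure (distr M borel (\<lambda>\<omega>. (?S \<omega>, ?Z \<omega>))) ({..a} \<times> {..b})
      = measure (sup_law q \<Otimes>\<^sub>M inf_law q) ({..a} \<times> {..b})" .
qed simp

lemma integral_wiener_hopf:
  fixes k :: "real \<times> real \<Rightarrow> real"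
  assumes q: "0 < q" and k: "k \<in> borel_measurable borel" "\<And>p. \<bar>k p\<bar> \<le> B"
  shows "(LINT \<omega>|M. k (running_sup X (T q \<omega>) \<omega>, X (T q \<omega>) \<omega> - running_sup X (T q \<omega>) \<omega>))
    = (LINT \<omega>|M. LINT \<omega>'|M. k (running_sup X (T q \<omega>) \<omega>, running_inf X (T q \<omega>') \<omega>'))"
proof -
  note [measurable] = measurable_at_T[OF q]
  interpret S: prob_space "sup_law q" unfolding sup_law_def by (rule prob_space_distr) measurable
  interpret I: prob_space "inf_law q" unfolding inf_law_def by (rule prob_space_distr) measurable
  interpret SI: pair_prob_space "sup_law q" "inf_law q" ..
  have sets [measurable_cong, simp]: "sets (sup_law q) = sets borel" "sets (inf_law q) = sets borel"
    by (simp_all add: sup_law_def inf_law_def)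
  have k2 [measurable]: "k \<in> borel_measurable (borel \<Otimes>\<^sub>M borel)" using k(1) by (simp add: borel_prod)
  have "(LINT \<omega>|M. k (running_sup X (T q \<omega>) \<omega>, X (T q \<omega>) \<omega> - running_sup X (T q \<omega>) \<omega>))
      = integral\<^sup>L (sup_law q \<Otimes>\<^sub>M inf_law q) k"
    unfolding wiener_hopf[OF q, symmetric] by (rule integral_distr[symmetric, OF _ k(1)]) measurable
  also have "\<dots> = (LINT s|sup_law q. LINT i|inf_law q. k (s, i))"
  proof (rule SI.integral_fst'[symmetric])
    have "k \<in> borel_measurable (sup_law q \<Otimes>\<^sub>M inf_law q)" by measurable
    then show "integrable (sup_law q \<Otimes>\<^sub>M inf_law q) k" using k(2) by (intro SI.integrable_const_bound[of _ B]) auto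
  qed
  also have "\<dots> = (LINT \<omega>|M. LINT i|inf_law q. k (running_sup X (T q \<omega>) \<omega>, i))"
  proof -
    have "(\<lambda>s. LINT i|inf_law q. k (s, i)) \<in> borel_measurable borel"
      by (intro I.borel_measurable_lebesgue_integral) measurable
    then show ?thesis unfolding sup_law_def by (intro integral_distr) measurable
  qed
  also have "(\<lambda>\<omega>. LINT i|inf_law q. k (running_sup X (T q \<omega>) \<omega>, i))
      = (\<lambda>\<omega>. LINT \<omega>'|M. k (running_sup X (T q \<omega>) \<omega>, running_inf X (T q \<omega>') \<omega>'))"
    unfolding inf_law_def by (intro ext integral_distr) measurable
  finally show ?thesis .
qed

end

section \<open>The joint value function\<close>

lemma closed_U_plus: "closed U_plus"
proof -
  have "U_plus = {p. 0 \<le> snd p} \<inter> {p. fst p \<le> snd p}" by (auto simp: U_plus_def)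
  moreover have "closed {p :: real \<times> real. 0 \<le> snd p}" "closed {p :: real \<times> real. fst p \<le> snd p}"
    by (intro closed_Collect_le continuous_intros)+
  ultimately show ?thesis by (metis closed_Int)
qed

lemma measurable_ext_zero:
  assumes "f \<in> borel_measurable (restrict_space borel U_plus)"
  shows "ext_zero f \<in> borel_measurable borel"
proof -
  have "(\<lambda>p. indicator U_plus p *\<^sub>R f p) \<in> borel_measurable borel"
    using assms closed_U_plus by (subst (asm) borel_measurable_restrict_space_iff) (auto intro: borel_closed)
  moreover have "ext_zero f = (\<lambda>p. indicator U_plus p *\<^sub>R f p)"
    by (auto simp: ext_zero_def fun_eq_iff)
  ultimately show ?thesis by simp
qed

lemma abs_ext_zero_le:
  assumes "bounded (f ` U_plus)"
  obtains B where "\<And>p. \<bar>ext_zero f p\<bar> \<le> B"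
proof -
  obtain B where B: "\<And>p. p \<in> U_plus \<Longrightarrow> \<bar>f p\<bar> \<le> B"
    using assms unfolding bounded_iff by auto
  have "\<bar>ext_zero f p\<bar> \<le> max B 0" for p using B[of p] by (auto simp: ext_zero_def)
  then show ?thesis by (rule that)
qed

text \<open>The function of \<open>triple\<close> whose expectation is the value function.\<close>

definition payoff :: "(real \<times> real \<Rightarrow> real) \<Rightarrow> real \<Rightarrow> real \<Rightarrow> real \<times> real \<times> real \<Rightarrow> real" where
  "payoff f x1 x2 p = ext_zero f (x1 + fst p, max x2 (x1 + fst (snd p)))"

lemma measurable_payoff:
  assumes f: "ext_zero f \<in> borel_measurable borel"
  shows "payoff f x1 x2 \<in> borel_measurable borel"
  unfolding payoff_def[abs_def] borel_prod[symmetric]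
  by (rule measurable_compose[OF _ f[folded borel_prod]]) measurable

context levy_process_exp_times
begin

lemma V_laplace_eq_mean_triple:
  assumes f: "ext_zero f \<in> borel_measurable borel"
  shows "V_laplace M X f q x1 x2 = (LINT t:{0<..}|lborel. exp (- q * t) * mean_triple (payoff f x1 x2) t)"
proof -
  have "V M X f t x1 x2 = mean_triple (payoff f x1 x2) t" if "0 < t" for t
    using that by (subst mean_triple_eq[OF measurable_payoff[OF f]]) (auto simp: V_def payoff_def triple_def)
  then show ?thesis
    unfolding V_laplace_def by (intro set_lebesgue_integral_cong) auto
qed

lemma q_times_V_laplace:
  assumes q: "0 < q" and f: "ext_zero f \<in> borel_measurable borel" and B: "\<And>p. \<bar>ext_zero f p\<bar> \<le> B"
  shows "q * V_laplace M X f q x1 x2 = (LINT \<omega>|M. payoff f x1 x2 (triple (T q \<omega>) \<omega>))"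
proof -
  have "\<bar>payoff f x1 x2 p\<bar> \<le> B" for p unfolding payoff_def by (rule B)
  from mean_triple_T[OF q measurable_payoff[OF f] this] show ?thesis
    unfolding V_laplace_eq_mean_triple[OF f]
    using integral_T_laplace[OF q measurable_mean_triple[OF measurable_payoff[OF f]]] by simp
qed

text \<open>If \<open>x1 + S < x2\<close> then \<open>max x2 (x1 + S)\<close> is \<open>x2\<close>. Otherwise it is \<open>x1 + S\<close>, and the correction \<open>k\<close> is a
  function of \<open>S\<close> and \<open>X\<^sub>T - S\<close>, since \<open>X\<^sub>T = S + (X\<^sub>T - S)\<close>. The Wiener-Hopf factorization
  replaces \<open>X\<^sub>T - S\<close> by an independent copy of the infimum, whose expectation is \<open>w\<close> at \<open>x1 + S\<close>.\<close>

lemma V_laplace_decomposition: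
  assumes q: "0 < q" and f [measurable]: "ext_zero f \<in> borel_measurable borel" and B: "\<And>p. \<bar>ext_zero f p\<bar> \<le> B"
  shows "q * V_laplace M X f q x1 x2 = tensor_id (EPV M X T q) (ext_zero f) (x1, x2)
           + EPV_sup M X T q (\<lambda>y. w M X T f q y x2) x1"
proof -
  note [measurable] = measurable_at_T[OF q]
  let ?X = "\<lambda>\<omega>. X (T q \<omega>) \<omega>" and ?S = "\<lambda>\<omega>. running_sup X (T q \<omega>) \<omega>" and ?I = "\<lambda>\<omega>. running_inf X (T q \<omega>) \<omega>"
  have f2 [measurable]: "ext_zero f \<in> borel_measurable (borel \<Otimes>\<^sub>M borel)" using f by (simp add: borel_prod)
  have int: "integrable M (\<lambda>\<omega>. ext_zero f (a \<omega>, b \<omega>))"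
    if [measurable]: "a \<in> borel_measurable M" "b \<in> borel_measurable M" for a b
    using B by (intro integrable_const_bound[of _ B]) auto
  define k where "k p = indicator {x2..} (x1 + fst p) *
    (ext_zero f (x1 + fst p + snd p, x1 + fst p) - ext_zero f (x1 + fst p + snd p, x2))" for p :: "real \<times> real"
  have k [measurable]: "k \<in> borel_measurable borel"
    unfolding k_def[abs_def] borel_prod[symmetric] by measurable
  have kB: "\<bar>k p\<bar> \<le> B + B" for p
  proof -
    have "\<bar>ext_zero f u - ext_zero f v\<bar> \<le> B + B" for u v using B[of u] B[of v] by linarith
    moreover have "0 \<le> B" using B[of 0] by linarith
    ultimately show ?thesis by (auto simp: k_def indicator_def abs_mult)
  qed
  have "w M X T f q (x1 + ?S \<omega>) x2 = (LINT \<omega>'|M. k (?S \<omega>, ?I \<omega>'))" for \<omega>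
    unfolding w_def tensor_id_def EPV_inf_def k_def by (simp add: int)
  then have "EPV_sup M X T q (\<lambda>y. w M X T f q y x2) x1 = (LINT \<omega>|M. LINT \<omega>'|M. k (?S \<omega>, ?I \<omega>'))"
    by (simp add: EPV_sup_def)
  also have "\<dots> = (LINT \<omega>|M. k (?S \<omega>, ?X \<omega> - ?S \<omega>))"
    by (rule integral_wiener_hopf[symmetric, OF q k kB])
  finally have "tensor_id (EPV M X T q) (ext_zero f) (x1, x2) + EPV_sup M X T q (\<lambda>y. w M X T f q y x2) x1
      = (LINT \<omega>|M. ext_zero f (x1 + ?X \<omega>, x2)) + (LINT \<omega>|M. k (?S \<omega>, ?X \<omega> - ?S \<omega>))"
    by (simp add: tensor_id_def EPV_def)
  also have "\<dots> = (LINT \<omega>|M. ext_zero f (x1 + ?X \<omega>, x2) + k (?S \<omega>, ?X \<omega> - ?S \<omega>))"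
  proof (rule Bochner_Integration.integral_add[symmetric])
    have "(\<lambda>\<omega>. (?S \<omega>, ?X \<omega> - ?S \<omega>)) \<in> borel_measurable M" by measurable
    from measurable_compose[OF this k] show "integrable M (\<lambda>\<omega>. k (?S \<omega>, ?X \<omega> - ?S \<omega>))"
      using kB by (intro integrable_const_bound[of _ "B + B"]) auto
  qed (rule int; measurable)
  also have "\<dots> = (LINT \<omega>|M. ext_zero f (x1 + ?X \<omega>, max x2 (x1 + ?S \<omega>)))"
    by (intro Bochner_Integration.integral_cong refl) (auto simp: k_def max_def indicator_def)
  also have "\<dots> = q * V_laplace M X f q x1 x2"
    by (simp add: q_times_V_laplace[OF q f B] payoff_def triple_def)
  finally show ?thesis by simp
qed

text \<open>By the decomposition at every rate \<open>p\<close>, the function to be continued is \<open>p\<close> times a Laplace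
  transform.\<close>

lemma continues_V_laplace:
  assumes f: "ext_zero f \<in> borel_measurable borel" and B: "\<And>p. \<bar>ext_zero f p\<bar> \<le> B"
  shows "continues_to_right_half_plane (\<lambda>p. tensor_id (EPV M X T p) (ext_zero f) (x1, x2)
           + EPV_sup M X T p (\<lambda>y. w M X T f p y x2) x1)"
proof -
  note g = measurable_payoff[OF f, of x1 x2]
  show ?thesis
  proof (rule continues_laplace_transform[OF measurable_mean_triple[OF g] abs_mean_triple_le[OF g]])
    show "\<bar>payoff f x1 x2 p\<bar> \<le> B" for p unfolding payoff_def by (rule B)
    show "tensor_id (EPV M X T p) (ext_zero f) (x1, x2) + EPV_sup M X T p (\<lambda>y. w M X T f p y x2) x1
        = p * (LINT t:{0<..}|lborel. exp (- p * t) * mean_triple (payoff f x1 x2) t)" if "0 < p" for p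
      unfolding V_laplace_decomposition[OF that f B, symmetric] V_laplace_eq_mean_triple[OF f] ..
  qed
qed

text \<open>Both terms of \<open>w\<close> are expectations of functions of the infimum at the exponential time, so they
  combine into the Laplace transform of a single function of time.\<close>

lemma continues_w:
  assumes f: "ext_zero f \<in> borel_measurable borel" and B: "\<And>p. \<bar>ext_zero f p\<bar> \<le> B"
  shows "continues_to_right_half_plane (\<lambda>p. w M X T f p y x2)"
proof -
  let ?g = "\<lambda>p :: real \<times> real \<times> real. indicator {x2..} y *
    (ext_zero f (y + snd (snd p), y) - ext_zero f (y + snd (snd p), x2)) :: real"
  have f2 [measurable]: "ext_zero f \<in> borel_measurable (borel \<Otimes>\<^sub>M borel)" using f by (simp add: borel_prod)
  have g: "?g \<in> borel_measurable borel"
    unfolding borel_prod[symmetric] by measurable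
  have gB: "\<bar>?g p\<bar> \<le> B + B" for p
  proof -
    have "\<bar>ext_zero f u - ext_zero f v\<bar> \<le> B + B" for u v using B[of u] B[of v] by linarith
    moreover have "0 \<le> B" using B[of 0] by linarith
    ultimately show ?thesis by (auto simp: indicator_def abs_mult)
  qed
  show ?thesis
  proof (rule continues_laplace_transform[OF measurable_mean_triple[OF g] abs_mean_triple_le[OF g gB]])
    fix p :: real assume p: "0 < p"
    note [measurable] = measurable_at_T[OF p]
    have int: "integrable M (\<lambda>\<omega>. ext_zero f (y + running_inf X (T p \<omega>) \<omega>, b))" for b
      using B by (intro integrable_const_bound[of _ B]) auto
    have "w M X T f p y x2 = (LINT \<omega>|M. ?g (triple (T p \<omega>) \<omega>))"
      unfolding w_def tensor_id_def EPV_inf_def triple_def by (simp add: int)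
    also have "\<dots> = p * (LINT t:{0<..}|lborel. exp (- p * t) * mean_triple ?g t)"
      unfolding mean_triple_T[OF p g gB] by (rule integral_T_laplace[OF p measurable_mean_triple[OF g]])
    finally show "w M X T f p y x2 = p * (LINT t:{0<..}|lborel. exp (- p * t) * mean_triple ?g t)" .
  qed
qed

end

theorem theorem3p1:
  fixes M :: "'a measure" and F :: "real \<Rightarrow> 'a measure"
    and X T :: "real \<Rightarrow> 'a \<Rightarrow> real"
    and f :: "real \<times> real \<Rightarrow> real" and q :: real
  assumes "levy_process_exp_times M F X T"
    and "0 < q"
    and "f \<in> borel_measurable (restrict_space borel U_plus)"
    and "bounded (f ` U_plus)"
    and "tensor_id (EPV_inf M X T q) (ext_zero f) \<circ> diag \<in> borel_measurable borel"
  shows "(\<forall>x1 x2. x1 \<le> x2 \<longrightarrow>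
            q * V_laplace M X f q x1 x2 =
              tensor_id (EPV M X T q) (ext_zero f) (x1, x2)
              + EPV_sup M X T q (\<lambda>y. w M X T f q y x2) x1)
       \<and> (\<forall>x1 x2. x1 \<le> x2 \<longrightarrow>
            continues_to_right_half_plane (\<lambda>p.
              tensor_id (EPV M X T p) (ext_zero f) (x1, x2)
              + EPV_sup M X T p (\<lambda>y. w M X T f p y x2) x1))
       \<and> (\<forall>y x2. continues_to_right_half_plane (\<lambda>p. w M X T f p y x2))"
proof -
  interpret levy_process_exp_times M F X T by fact
  have f: "ext_zero f \<in> borel_measurable borel" using assms(3) by (rule measurable_ext_zero)
  obtain B where B: "\<And>p. \<bar>ext_zero f p\<bar> \<le> B" using abs_ext_zero_le[OF assms(4)] by blast
  show ?thesis
    using V_laplace_decomposition[OF assms(2) f B] continues_V_laplace[OF f B] continues_w[OF f B] by blast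
qed

end
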